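(* Let $\mathbb{K}$ be a field, $m\ge 1$, $n=2m-1$, $S=\mathbb{K}[x_1,\ldots,x_n]$, and let $X=X_m^{(1,n)}$ be the $m\times m$ generic Hankel matrix with entries $x_1,\ldots,x_n$. Let $f=\det X\cdot\det X_{m-1}^{(2,n-1)}\in S$. Then $I_t(X)\in\mathcal{C}_f$ for $t=1,\ldots,m$.
   Context: For integers $l\le n$ and $m$, $X_m^{(l,n)}$ denotes the generic Hankel matrix with $m$ rows and $n-m-l+2$ columns whose $(i,j)$ entry is $x_{l+i+j-2}$ (so its entries are $x_l,\ldots,x_n$). For a matrix $M$, $I_t(M)$ is the ideal of $S$ generated by all $t\times t$ minors of $M$. For $f\in S$, $\mathcal{C}_f$ denotes the smallest set of ideals of $S$ such that: (1) $(f)\in\mathcal{C}_f$; (2) if $I\in\mathcal{C}_f$ then $I:J\in\mathcal{C}_f$ for every ideal $J\subseteq S$; (3) if $I,J\in\mathcal{C}_f$ then $I+J\in\mathcal{C}_f$ and $I\cap J\in\mathcal{C}_f$. *)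

theory Defs
  imports "HOL-Library.Poly_Mapping" "Jordan_Normal_Form.Determinant" "Jordan_Normal_Form.DL_Submatrix"
begin

type_synonym 'a mpoly = "(nat \<Rightarrow>\<^sub>0 nat) \<Rightarrow>\<^sub>0 'a"

definition var :: "nat \<Rightarrow> 'a::comm_ring_1 mpoly" where
  "var i = Poly_Mapping.single (Poly_Mapping.single i 1) 1"

definition polyring :: "nat \<Rightarrow> 'a::comm_ring_1 mpoly set" where
  "polyring n = {p. \<forall>mon \<in> Poly_Mapping.keys p. Poly_Mapping.keys mon \<subseteq> {1..n}}"

definition is_ideal :: "'a::comm_ring_1 set \<Rightarrow> 'a set \<Rightarrow> bool" where
  "is_ideal S I \<longleftrightarrow> I \<subseteq> S \<and> 0 \<in> I \<and> (\<forall>a\<in>I. \<forall>b\<in>I. a + b \<in> I)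
     \<and> (\<forall>a\<in>I. \<forall>r\<in>S. r * a \<in> I)"

definition ideal_gen :: "'a::comm_ring_1 set \<Rightarrow> 'a set \<Rightarrow> 'a set" where
  "ideal_gen S A = \<Inter>{I. is_ideal S I \<and> A \<subseteq> I}"

definition ideal_colon :: "'a::comm_ring_1 set \<Rightarrow> 'a set \<Rightarrow> 'a set \<Rightarrow> 'a set" where
  "ideal_colon S I J = {a \<in> S. \<forall>b\<in>J. a * b \<in> I}"

definition ideal_sum :: "'a::comm_ring_1 set \<Rightarrow> 'a set \<Rightarrow> 'a set" where
  "ideal_sum I J = {a + b |a b. a \<in> I \<and> b \<in> J}"

inductive_set classC :: "'a::comm_ring_1 set \<Rightarrow> 'a \<Rightarrow> 'a set set" for S f where
  base: "ideal_gen S {f} \<in> classC S f"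
| colon: "I \<in> classC S f \<Longrightarrow> is_ideal S J \<Longrightarrow> ideal_colon S I J \<in> classC S f"
| sum: "I \<in> classC S f \<Longrightarrow> J \<in> classC S f \<Longrightarrow> ideal_sum I J \<in> classC S f"
| inter: "I \<in> classC S f \<Longrightarrow> J \<in> classC S f \<Longrightarrow> I \<inter> J \<in> classC S f"

text \<open>Generic Hankel matrix X_m^{(l,n)}: m rows, n-m-l+2 columns, (i,j) entry
  x_{l+i+j-2} with 1-based indices, i.e. x_{l+i+j} with 0-based indices.\<close>
definition hankel :: "nat \<Rightarrow> nat \<Rightarrow> nat \<Rightarrow> 'a::comm_ring_1 mpoly mat" where
  "hankel m l n = mat m (n + 2 - m - l) (\<lambda>(i, j). var (l + i + j))"

definition minors :: "nat \<Rightarrow> 'a::comm_ring_1 mat \<Rightarrow> 'a set" where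
  "minors t M = {det (submatrix M R C) |R C.
      R \<subseteq> {..<dim_row M} \<and> C \<subseteq> {..<dim_col M} \<and> card R = t \<and> card C = t}"

definition minor_ideal :: "'a::comm_ring_1 set \<Rightarrow> nat \<Rightarrow> 'a mat \<Rightarrow> 'a set" where
  "minor_ideal S t M = ideal_gen S (minors t M)"

end

(*
  Let K(t,a,b) be the kernel of the substitution sending x_k, for a <= k <= b, to
  sum_{s<t-1} c_s u_s^k with new variables c_s, u_s (a generic point of a secant variety of the
  rational normal curve) and fixing the other variables; it is a prime ideal. In the lexicographic
  order with x_1 > x_2 > ..., the leading monomial of a nonzero p in K(t,a,b) is divisible by
  some x_{e_1} ... x_{e_t} with indices in [a,b] and e_{j+1} >= e_j + 2, and each such product leads a
  t-minor of the square Hankel matrix. So these minors form a Groebner basis of K(t,a,b), and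
  I_t(X) = K(t,1,n). Comparing leading monomials gives, for 1 <= t < m,
    K(t,1,n-1) Int K(t,2,n)   = K(t+1,1,n) + K(t,2,n-1),
    K(t,1,n) Int K(t-1,2,n-1) = K(t,1,n-1) + K(t,2,n)   (reading K(0,2,n-1) as the unit ideal).
  Each of these primes is therefore the colon of a sum of two ideals by the other prime, and one
  descends from (det X) = K(m,1,n) and (det X') = K(m-1,2,n-1), the colons of (f) by its factors.
*)

theory Submission
  imports Defs
begin

text \<open>Taking kernels as the definition makes primality free, since over a field the target is
  a domain; the burden is to control leading monomials. For this the points are added one at a time,
  by x_k -> x_k + c u^k, and the x_k of the range are sent to 0 only at the end. Expanding such a
  step marks every replaced factor q of a monomial by c^deg(q) u^weight(q), where x_k has weight k;
  fixing these two exponents isolates a leading term that can be followed to the next step.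

  The sums lie in the intersections for a reason of rank: x_1 and x_n each fill one corner of the
  square matrix, so exempting one of them from the substitution raises the rank by at most one. The
  reverse inclusions interlace two spread tuples found in one monomial. Either they can be spliced
  into a tuple of the required kind, or they stay so close together that they fill the index range;
  this forces n = 2t in the first formula and n <= 2t - 1 in the second. Oddness of n rules out the
  one, t < m the other.\<close>

abbreviation "lookup \<equiv> Poly_Mapping.lookup"
abbreviation "keys \<equiv> Poly_Mapping.keys"
abbreviation "single \<equiv> Poly_Mapping.single"

section \<open>Substitution homomorphisms\<close>

lemma lookup_single_mult:
  fixes p :: "'a::comm_ring_1 mpoly"
  shows "lookup (single m c * p) (m + k) = c * lookup p k"
proof -
  have "lookup (single m c * p) (m + k) = (\<Sum>l. lookup (single m c) l * (\<Sum>q. lookup p q when m + k = l + q))"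
    by (simp add: lookup_mult)
  also have "\<dots> = (\<Sum>l. (c * (\<Sum>q. lookup p q when m + k = m + q)) when m = l)"
    by (rule Sum_any.cong) (auto simp: lookup_single when_def)
  also have "\<dots> = c * lookup p k"
    by (simp add: when_def[symmetric])
  finally show ?thesis .
qed

lemma lookup_const_mult:
  fixes p :: "'a::comm_ring_1 mpoly"
  shows "lookup (single 0 c * p) k = c * lookup p k"
  using lookup_single_mult[of 0 c p k] by simp

lemma in_keys_single_mult:
  fixes p :: "'a::comm_ring_1 mpoly"
  assumes "lookup (single m c * p) k \<noteq> 0"
  obtains l where "k = m + l" "l \<in> keys p"
proof -
  have "k \<in> keys (single m c * p)" using assms by (simp add: in_keys_iff)
  then show ?thesis using keys_mult[of "single m c" p] that by (fastforce split: if_splits)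
qed

lemma poly_mapping_eq_sum_single:
  fixes p :: "'a::comm_ring_1 mpoly"
  shows "p = (\<Sum>m\<in>keys p. single m (lookup p m))"
proof (rule poly_mapping_eqI)
  fix k
  have "lookup (\<Sum>m\<in>keys p. single m (lookup p m)) k = (\<Sum>m\<in>keys p. if m = k then lookup p m else 0)"
    unfolding lookup_sum by (rule sum.cong) (auto simp: lookup_single when_def)
  also have "\<dots> = lookup p k" by (simp add: in_keys_iff)
  finally show "lookup p k = lookup (\<Sum>m\<in>keys p. single m (lookup p m)) k" by simp
qed

definition mon_subst :: "(nat \<Rightarrow> 'a::comm_ring_1 mpoly) \<Rightarrow> (nat \<Rightarrow>\<^sub>0 nat) \<Rightarrow> 'a mpoly" where
  "mon_subst s m = (\<Prod>k\<in>keys m. s k ^ lookup m k)"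

definition poly_subst :: "(nat \<Rightarrow> 'a::comm_ring_1 mpoly) \<Rightarrow> 'a mpoly \<Rightarrow> 'a mpoly" where
  "poly_subst s p = (\<Sum>m\<in>keys p. single 0 (lookup p m) * mon_subst s m)"

lemma mon_subst_superset:
  assumes "finite A" "keys m \<subseteq> A"
  shows "mon_subst s m = (\<Prod>k\<in>A. s k ^ lookup m k)"
  unfolding mon_subst_def using assms
  by (intro prod.mono_neutral_left) (auto simp: in_keys_iff)

lemma mon_subst_zero [simp]: "mon_subst s 0 = 1"
  by (simp add: mon_subst_def)

lemma mon_subst_single: "mon_subst s (single k (Suc 0)) = s k"
  by (simp add: mon_subst_def)

lemma mon_subst_add: "mon_subst s (m + m') = mon_subst s m * mon_subst s m'"
proof -
  let ?A = "keys m \<union> keys m'"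
  have "mon_subst s (m + m') = (\<Prod>k\<in>?A. s k ^ lookup (m + m') k)"
    by (rule mon_subst_superset) (simp_all add: keys_add)
  also have "\<dots> = (\<Prod>k\<in>?A. s k ^ lookup m k) * (\<Prod>k\<in>?A. s k ^ lookup m' k)"
    by (simp add: lookup_add power_add prod.distrib)
  also have "\<dots> = mon_subst s m * mon_subst s m'"
    by (simp add: mon_subst_superset[of ?A])
  finally show ?thesis .
qed

lemma poly_subst_superset:
  assumes "finite A" "keys p \<subseteq> A"
  shows "poly_subst s p = (\<Sum>m\<in>A. single 0 (lookup p m) * mon_subst s m)"
  unfolding poly_subst_def using assms
  by (intro sum.mono_neutral_left) (auto simp: in_keys_iff)

lemma poly_subst_add: "poly_subst s (p + q) = poly_subst s p + poly_subst s q"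
proof -
  let ?A = "keys p \<union> keys q"
  have "poly_subst s (p + q) = (\<Sum>m\<in>?A. single 0 (lookup (p + q) m) * mon_subst s m)"
    by (rule poly_subst_superset) (simp_all add: keys_add)
  also have "\<dots> = (\<Sum>m\<in>?A. single 0 (lookup p m) * mon_subst s m) + (\<Sum>m\<in>?A. single 0 (lookup q m) * mon_subst s m)"
    by (simp add: lookup_add single_add distrib_right sum.distrib)
  also have "\<dots> = poly_subst s p + poly_subst s q"
    by (simp add: poly_subst_superset[of ?A])
  finally show ?thesis .
qed

lemma poly_subst_zero [simp]: "poly_subst s 0 = 0"
  by (simp add: poly_subst_def)

lemma poly_subst_sum: "poly_subst s (\<Sum>i\<in>A. f i) = (\<Sum>i\<in>A. poly_subst s (f i))"
  by (induction A rule: infinite_finite_induct) (auto simp: poly_subst_add)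

lemma poly_subst_single: "poly_subst s (single m c) = single 0 c * mon_subst s m"
  by (simp add: poly_subst_superset[of "{m}"])

lemma poly_subst_mult: "poly_subst s (p * q) = poly_subst s p * poly_subst s q"
proof -
  have "p * q = (\<Sum>m\<in>keys p. \<Sum>m'\<in>keys q. single m (lookup p m) * single m' (lookup q m'))"
    unfolding sum_product[symmetric] poly_mapping_eq_sum_single[symmetric] ..
  then have "poly_subst s (p * q) = (\<Sum>m\<in>keys p. \<Sum>m'\<in>keys q.
      (single 0 (lookup p m) * mon_subst s m) * (single 0 (lookup q m') * mon_subst s m'))"
    by (simp add: poly_subst_sum mult_single poly_subst_single mon_subst_add)
       (simp add: mult_single[of 0 _ 0, simplified, symmetric] mult_ac)
  also have "\<dots> = poly_subst s p * poly_subst s q"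
    by (simp add: poly_subst_def sum_product)
  finally show ?thesis .
qed

lemma poly_subst_hom: "comm_ring_hom (poly_subst s)"
proof
  show "poly_subst s 1 = 1"
    using poly_subst_single[of s 0 1] by simp
qed (simp_all add: poly_subst_add poly_subst_mult)

lemma poly_subst_var [simp]: "poly_subst s (var k) = s k"
  by (simp add: var_def poly_subst_single mon_subst_single)

lemma var_power: "var k ^ d = single (single k d) 1"
  by (induction d) (simp_all add: var_def mult_single single_add[symmetric])

lemma mon_add_single_induct [case_names zero add]:
  fixes m :: "nat \<Rightarrow>\<^sub>0 nat"
  assumes "P 0" "\<And>m k. P m \<Longrightarrow> P (m + single k 1)"
  shows "P m"
proof (induction "\<Sum>k\<in>keys m. lookup m k" arbitrary: m)
  case 0
  then have "m = 0" by (auto simp: in_keys_iff intro!: poly_mapping_eqI)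
  then show ?case using assms by simp
next
  case (Suc d)
  then obtain k where k: "k \<in> keys m" by (metis sum.neutral_const ex_in_conv sum.empty Zero_not_Suc)
  define m' where "m' = m - single k 1"
  have m: "m = m' + single k 1"
    by (rule poly_mapping_eqI) (use k in \<open>auto simp: m'_def lookup_add lookup_minus lookup_single when_def in_keys_iff\<close>)
  have "(\<Sum>k\<in>keys m. lookup m k) = (\<Sum>j\<in>keys m. lookup m' j) + 1"
    using k by (subst m) (simp add: lookup_add sum.distrib lookup_single when_def)
  also have "(\<Sum>j\<in>keys m. lookup m' j) = (\<Sum>j\<in>keys m'. lookup m' j)"
    by (intro sum.mono_neutral_right) (auto simp: in_keys_iff m lookup_add)
  finally show ?case using Suc assms(2) m by auto
qed

section \<open>The lexicographic order on monomials\<close>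

text \<open>The order that comes with finitely supported functions is thus the lexicographic one
  with small indices as large variables, and it is compatible with multiplication.\<close>

lemma mon_less_iff:
  fixes m m' :: "nat \<Rightarrow>\<^sub>0 nat"
  shows "m < m' \<longleftrightarrow> (\<exists>k. lookup m k < lookup m' k \<and> (\<forall>k'<k. lookup m k' = lookup m' k'))"
  by (simp add: less_poly_mapping.rep_eq less_fun_def)

lemma keys_add_nat: "keys (m + m' :: nat \<Rightarrow>\<^sub>0 nat) = keys m \<union> keys m'"
  by (auto simp: in_keys_iff lookup_add)

definition mdeg :: "(nat \<Rightarrow>\<^sub>0 nat) \<Rightarrow> nat" where
  "mdeg m = (\<Sum>k\<in>keys m. lookup m k)"

text \<open>The exponent of u that arises when every x_k of a monomial is replaced by c u^k;
  \<open>mdeg\<close> is the exponent of c.\<close>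

definition mweight :: "(nat \<Rightarrow>\<^sub>0 nat) \<Rightarrow> nat" where
  "mweight m = (\<Sum>k\<in>keys m. k * lookup m k)"

lemma mdeg_superset: "finite A \<Longrightarrow> keys m \<subseteq> A \<Longrightarrow> mdeg m = (\<Sum>k\<in>A. lookup m k)"
  unfolding mdeg_def by (intro sum.mono_neutral_left) (auto simp: in_keys_iff)

lemma mweight_superset: "finite A \<Longrightarrow> keys m \<subseteq> A \<Longrightarrow> mweight m = (\<Sum>k\<in>A. k * lookup m k)"
  unfolding mweight_def by (intro sum.mono_neutral_left) (auto simp: in_keys_iff)

lemma mdeg_add: "mdeg (m + m') = mdeg m + mdeg m'"
  by (simp add: mdeg_superset[of "keys m \<union> keys m'"] keys_add_nat lookup_add sum.distrib)

lemma mweight_add: "mweight (m + m') = mweight m + mweight m'"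
  by (simp add: mweight_superset[of "keys m \<union> keys m'"] keys_add_nat lookup_add sum.distrib distrib_left)

lemma mdeg_zero [simp]: "mdeg 0 = 0" by (simp add: mdeg_def)
lemma mweight_zero [simp]: "mweight 0 = 0" by (simp add: mweight_def)
lemma mdeg_single [simp]: "mdeg (single k d) = d" by (simp add: mdeg_def)
lemma mweight_single [simp]: "mweight (single k d) = k * d" by (simp add: mweight_def)

text \<open>A q below this monomial has no index under i and too few factors x_i, or the right
  number of these and too few x_(i+1). Its other factors then have indices so large that the weight
  is exceeded.\<close>

lemma adjacent_mon_least:
  fixes q :: "nat \<Rightarrow>\<^sub>0 nat"
  assumes "mdeg q = \<alpha> + \<beta>" "mweight q = i * \<alpha> + Suc i * \<beta>"
  shows "single i \<alpha> + single (Suc i) \<beta> \<le> q"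
proof (rule ccontr)
  assume "\<not> ?thesis"
  then have "q < single i \<alpha> + single (Suc i) \<beta>" by simp
  then obtain k where k: "lookup q k < lookup (single i \<alpha> + single (Suc i) \<beta>) k"
    and below: "\<And>k'. k' < k \<Longrightarrow> lookup q k' = lookup (single i \<alpha> + single (Suc i) \<beta>) k'"
    unfolding mon_less_iff by blast
  let ?A = "insert i (insert (Suc i) (keys q))"
  have deg: "(\<Sum>j\<in>?A. lookup q j) = \<alpha> + \<beta>"
    using assms(1) by (subst (asm) mdeg_superset[of ?A]) auto
  have wt: "(\<Sum>j\<in>?A. j * lookup q j) = i * \<alpha> + Suc i * \<beta>"
    using assms(2) by (subst (asm) mweight_superset[of ?A]) auto
  have "k = i \<or> k = Suc i"
    using k by (auto simp: lookup_add lookup_single when_def split: if_splits)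
  then show False
  proof
    assume [simp]: "k = i"
    have low: "lookup q j = 0" if "j < i" for j
      using below[of j] that by (simp add: lookup_add lookup_single when_def)
    \<comment> \<open>Each factor x_i falls short of index i + 1 by one; all other factors of q have
      index at least i + 1.\<close>
    have "(\<Sum>j\<in>?A. Suc i * lookup q j) \<le> (\<Sum>j\<in>?A. j * lookup q j + (if j = i then lookup q i else 0))"
    proof (rule sum_mono)
      fix j show "Suc i * lookup q j \<le> j * lookup q j + (if j = i then lookup q i else 0)"
      proof (cases "j \<le> i")
        case True then show ?thesis using low[of j] by (cases "j = i") auto
      next
        case False
        then have "Suc i * lookup q j \<le> j * lookup q j" by (intro mult_right_mono) auto
        then show ?thesis by simp
      qed
    qed
    also have "\<dots> = i * \<alpha> + Suc i * \<beta> + lookup q i"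
      by (subst sum.distrib, subst wt) simp
    finally have "Suc i * (\<alpha> + \<beta>) \<le> i * \<alpha> + Suc i * \<beta> + lookup q i"
      by (simp only: sum_distrib_left[symmetric] deg)
    then show False using k by (simp add: lookup_add lookup_single when_def algebra_simps)
  next
    assume [simp]: "k = Suc i"
    have low: "lookup q j = 0" if "j < i" for j
      using below[of j] that by (simp add: lookup_add lookup_single when_def)
    have qi: "lookup q i = \<alpha>"
      using below[of i] by (simp add: lookup_add lookup_single when_def)
    \<comment> \<open>Now the bound is i + 2, missed by two for x_i and by one for x_(i+1).\<close>
    have "(\<Sum>j\<in>?A. Suc (Suc i) * lookup q j) \<le> (\<Sum>j\<in>?A. j * lookup q j
       + (if j = i then 2 * lookup q i else 0) + (if j = Suc i then lookup q (Suc i) else 0))"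
    proof (rule sum_mono)
      fix j show "Suc (Suc i) * lookup q j \<le> j * lookup q j
          + (if j = i then 2 * lookup q i else 0) + (if j = Suc i then lookup q (Suc i) else 0)"
      proof (cases "j \<le> Suc i")
        case True then show ?thesis using low[of j] by (cases "j = i"; cases "j = Suc i") auto
      next
        case False
        then have "Suc (Suc i) * lookup q j \<le> j * lookup q j" by (intro mult_right_mono) auto
        then show ?thesis by simp
      qed
    qed
    also have "\<dots> = i * \<alpha> + Suc i * \<beta> + 2 * \<alpha> + lookup q (Suc i)"
      by (subst sum.distrib, subst sum.distrib, subst wt) (simp add: qi)
    finally have "Suc (Suc i) * (\<alpha> + \<beta>) \<le> i * \<alpha> + Suc i * \<beta> + 2 * \<alpha> + lookup q (Suc i)"
      by (simp only: sum_distrib_left[symmetric] deg)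
    then show False using k by (simp add: lookup_add lookup_single when_def algebra_simps)
  qed
qed

section \<open>Spread tuples\<close>

text \<open>Gap two is what the diagonal of a Hankel minor has: from one diagonal entry to the next
  both the row and the column index grow.\<close>

definition spread :: "nat \<Rightarrow> (nat \<Rightarrow> nat) \<Rightarrow> bool" where
  "spread t e \<longleftrightarrow> (\<forall>j. Suc j < t \<longrightarrow> e j + 2 \<le> e (Suc j))"

definition has_spread :: "nat \<Rightarrow> nat set \<Rightarrow> bool" where
  "has_spread t A \<longleftrightarrow> (\<exists>e. spread t e \<and> (\<forall>j<t. e j \<in> A))"

lemma spread_gap:
  assumes "spread t e" "i + d < t"
  shows "e i + 2 * d \<le> e (i + d)"
  using assms(2)
proof (induction d)
  case (Suc d)
  then have "e (i + d) + 2 \<le> e (Suc (i + d))" using assms(1) by (auto simp: spread_def)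
  then show ?case using Suc by simp
qed simp

lemma spread_less:
  assumes "spread t e" "i < j" "j < t"
  shows "e i + 2 \<le> e j"
proof -
  have "e i + 2 * (j - i) \<le> e (i + (j - i))"
    by (rule spread_gap[OF assms(1)]) (use assms in auto)
  moreover have "2 * 1 \<le> 2 * (j - i)" using assms by (intro mult_le_mono) auto
  ultimately show ?thesis using assms by simp
qed

lemma spread_inj_on: "spread t e \<Longrightarrow> inj_on e {..<t}"
  by (rule linorder_inj_onI) (use spread_less in force)+

lemma has_spread_card:
  assumes "has_spread t A" "finite A"
  shows "t \<le> card A"
proof -
  from assms obtain e where e: "spread t e" "\<forall>j<t. e j \<in> A" by (auto simp: has_spread_def)
  have "card (e ` {..<t}) = t" by (simp add: card_image spread_inj_on e)
  moreover have "card (e ` {..<t}) \<le> card A" using e assms by (intro card_mono) auto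
  ultimately show ?thesis by simp
qed

text \<open>A spread tuple in \<nu> starts at i + 2 or later, i being the least index of the range
  in \<mu>, so i could be put in front of it. This is why one point costs one unit of
  length.\<close>

lemma mon_split_adjacent:
  fixes \<mu> :: "nat \<Rightarrow>\<^sub>0 nat"
  assumes "\<not> has_spread (Suc (Suc r)) (keys \<mu> \<inter> {a..b})"
  obtains i \<alpha> \<beta> \<nu> q where "q = single i \<alpha> + single (Suc i) \<beta>" "\<mu> = \<nu> + q" "keys q \<subseteq> {a..b}"
    "keys q \<inter> keys \<nu> = {}" "\<not> has_spread (Suc r) (keys \<nu> \<inter> {a..b})"
proof (cases "keys \<mu> \<inter> {a..b} = {}")
  case True
  show ?thesis
    \<comment> \<open>Nothing in the range: q is the monomial 1.\<close>
    by (rule that[of 0 0 0 0 \<mu>]) (use True in \<open>auto simp: has_spread_def\<close>)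
next
  case False
  define i where "i = Min (keys \<mu> \<inter> {a..b})"
  have i: "i \<in> keys \<mu>" "i \<in> {a..b}"
    using Min_in[of "keys \<mu> \<inter> {a..b}"] False by (auto simp: i_def)
  have i_le: "i \<le> j" if "j \<in> keys \<mu>" "j \<in> {a..b}" for j
    using that by (auto simp: i_def)
  \<comment> \<open>When i = b, the variable x_(i+1) lies outside the range, is not substituted, and
    stays in \<nu>.\<close>
  define \<beta> where "\<beta> = (if Suc i \<le> b then lookup \<mu> (Suc i) else 0)"
  define q where "q = single i (lookup \<mu> i) + single (Suc i) \<beta>"
  define \<nu> where "\<nu> = \<mu> - q"
  have q: "lookup q j = (if j = i then lookup \<mu> i else if j = Suc i then \<beta> else 0)" for j
    by (simp add: q_def lookup_add lookup_single when_def)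
  have \<nu>: "lookup \<nu> j = (if j = i then 0 else if j = Suc i then lookup \<mu> j - \<beta> else lookup \<mu> j)" for j
    by (simp add: \<nu>_def lookup_minus q)
  have \<nu>_keys: "i \<notin> keys \<nu> \<inter> {a..b}" "Suc i \<notin> keys \<nu> \<inter> {a..b}" "keys \<nu> \<subseteq> keys \<mu>"
    by (auto simp: in_keys_iff \<nu> \<beta>_def split: if_splits)
  show ?thesis
  proof (rule that)
    show "q = single i (lookup \<mu> i) + single (Suc i) \<beta>" by (rule q_def)
    show "\<mu> = \<nu> + q"
      by (rule poly_mapping_eqI) (simp add: lookup_add \<nu> q \<beta>_def)
    show "keys q \<subseteq> {a..b}" using i by (auto simp: in_keys_iff q \<beta>_def split: if_splits)
    show "keys q \<inter> keys \<nu> = {}" by (auto simp: in_keys_iff q \<nu> \<beta>_def split: if_splits)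
    show "\<not> has_spread (Suc r) (keys \<nu> \<inter> {a..b})"
    proof
      assume "has_spread (Suc r) (keys \<nu> \<inter> {a..b})"
      then obtain e where e: "spread (Suc r) e" "\<forall>j<Suc r. e j \<in> keys \<nu> \<inter> {a..b}"
        by (auto simp: has_spread_def)
      have e0: "e 0 \<in> keys \<nu> \<inter> {a..b}" using e by simp
      then have "e 0 \<noteq> i" "e 0 \<noteq> Suc i" "i \<le> e 0"
        using \<nu>_keys i_le[of "e 0"] by fastforce+
      then have e0': "i + 2 \<le> e 0" by simp
      let ?e = "\<lambda>j. case j of 0 \<Rightarrow> i | Suc j \<Rightarrow> e j"
      have "spread (Suc (Suc r)) ?e"
        unfolding spread_def
      proof (intro allI impI)
        fix j assume "Suc j < Suc (Suc r)"
        then show "?e j + 2 \<le> ?e (Suc j)"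
          using e(1) e0' by (cases j) (auto simp: spread_def)
      qed
      moreover have "?e j \<in> keys \<mu> \<inter> {a..b}" if "j < Suc (Suc r)" for j
        using that i e(2) \<nu>_keys(3) by (cases j) auto
      ultimately show False using assms unfolding has_spread_def by blast
    qed
  qed
qed

section \<open>Points on the secant variety of the rational normal curve\<close>

text \<open>\<open>var (N + 2 * s)\<close> and \<open>var (N + 2 * s + 1)\<close> play the roles of \<open>c\<^sub>s\<close> and \<open>u\<^sub>s\<close>.\<close>

definition add_point :: "nat \<Rightarrow> nat \<Rightarrow> nat \<Rightarrow> nat \<Rightarrow> nat \<Rightarrow> 'a::comm_ring_1 mpoly" where
  "add_point a b c u k = (if a \<le> k \<and> k \<le> b then var k + var c * var u ^ k else var k)"

text \<open>A composition of one-point substitutions instead of a single substitution by the whole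
  sum, so that proofs can peel off the points. The last point goes first; for b < N the remaining
  steps leave its two variables alone.\<close>

fun secant :: "nat \<Rightarrow> nat \<Rightarrow> nat \<Rightarrow> nat \<Rightarrow> 'a::comm_ring_1 mpoly \<Rightarrow> 'a mpoly" where
  "secant N a b 0 p = poly_subst (\<lambda>k. if a \<le> k \<and> k \<le> b then 0 else var k) p"
| "secant N a b (Suc r) p = secant N a b r (poly_subst (add_point a b (N + 2 * r) (Suc (N + 2 * r))) p)"

lemma secant_hom: "comm_ring_hom (secant N a b r :: 'a::comm_ring_1 mpoly \<Rightarrow> 'a mpoly)"
proof (induction r)
  case 0
  interpret s: comm_ring_hom "poly_subst (\<lambda>k. if a \<le> k \<and> k \<le> b then 0 else var k :: 'a mpoly)"
    by (rule poly_subst_hom)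
  show ?case by unfold_locales (simp_all add: s.hom_add s.hom_mult)
next
  case (Suc r)
  interpret h: comm_ring_hom "secant N a b r :: 'a mpoly \<Rightarrow> 'a mpoly" by fact
  interpret s: comm_ring_hom "poly_subst (add_point a b (N + 2 * r) (Suc (N + 2 * r)) :: nat \<Rightarrow> 'a mpoly)"
    by (rule poly_subst_hom)
  show ?case by unfold_locales (simp_all add: h.hom_add h.hom_mult s.hom_add s.hom_mult)
qed

lemma secant_var_outside: "k < a \<or> b < k \<Longrightarrow> secant N a b r (var k) = var k"
  by (induction r) (auto simp: add_point_def)

lemma secant_var_inside:
  assumes "a \<le> k" "k \<le> b" "b < N"
  shows "secant N a b r (var k) = (\<Sum>s<r. var (N + 2 * s) * var (Suc (N + 2 * s)) ^ k)"
proof (induction r)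
  case (Suc r)
  interpret h: comm_ring_hom "secant N a b r" by (rule secant_hom)
  show ?case using assms Suc
    by (simp add: add_point_def h.hom_add h.hom_mult h.hom_power secant_var_outside)
qed (use assms in simp)

lemma add_point_eq:
  "add_point a b c u k = single (single k 1) 1
     + (if a \<le> k \<and> k \<le> b then single (single c 1 + single u k) 1 else 0)"
  by (simp add: add_point_def var_power mult_single) (simp add: var_def mult_single)

text \<open>In the expanded product of the x_k + c u^k, q collects the variables for which the
  second summand is chosen, and m' the others.\<close>

lemma keys_mon_subst_add_point:
  assumes "M \<in> keys (mon_subst (add_point a b c u :: nat \<Rightarrow> 'a::comm_ring_1 mpoly) m)"
  obtains m' q where "m = m' + q" "keys q \<subseteq> {a..b}" "M = m' + single c (mdeg q) + single u (mweight q)"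
proof -
  have "\<exists>m' q. m = m' + q \<and> keys q \<subseteq> {a..b} \<and> M = m' + single c (mdeg q) + single u (mweight q)"
    using assms
  proof (induction m arbitrary: M rule: mon_add_single_induct)
    case zero
    then show ?case by (intro exI[of _ 0]) (auto split: if_splits)
  next
    case (add m k)
    from add.prems have "M \<in> keys (mon_subst (add_point a b c u) m * add_point a b c u k :: 'a mpoly)"
      by (simp add: mon_subst_add mon_subst_single)
    then obtain M1 M2 where M: "M = M1 + M2"
      "M1 \<in> keys (mon_subst (add_point a b c u) m :: 'a mpoly)"
      "M2 \<in> keys (add_point a b c u k :: 'a mpoly)"
      using keys_mult by blast
    from add.IH[OF M(2)] obtain m' q where IH: "m = m' + q" "keys q \<subseteq> {a..b}"
      "M1 = m' + single c (mdeg q) + single u (mweight q)" by blast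
    have "M2 \<in> keys (single (single k 1) (1::'a))
       \<union> keys (if a \<le> k \<and> k \<le> b then single (single c 1 + single u k) (1::'a) else 0)"
      using M(3) unfolding add_point_eq by (rule subsetD[OF keys_add, rotated])
    then consider "M2 = single k 1" | "M2 = single c 1 + single u k" "k \<in> {a..b}"
      by (auto split: if_splits)
    then show ?case
    proof cases
      case 1
      show ?thesis
        by (rule exI[of _ "m' + single k 1"], rule exI[of _ q]) (use IH M 1 in \<open>auto simp: ac_simps\<close>)
    next
      case 2
      have "M = m' + single c (mdeg (q + single k 1)) + single u (mweight (q + single k 1))"
        by (rule poly_mapping_eqI)
           (simp add: M IH 2 lookup_add lookup_single when_def mdeg_add mweight_add)
      then show ?thesis
        by (intro exI[of _ m'] exI[of _ "q + single k 1"])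
           (use IH 2 in \<open>auto simp: add.assoc keys_add_nat\<close>)
    qed
  qed
  then show ?thesis using that by blast
qed

lemma lookup_add_point_mult:
  fixes p :: "'a::comm_ring_1 mpoly"
  shows "lookup (mon_subst (add_point a b c u) (m + single k 1)) M
    = lookup (single (single k 1) (1::'a) * mon_subst (add_point a b c u) m) M
      + (if a \<le> k \<and> k \<le> b then lookup (single (single c 1 + single u k) (1::'a) * mon_subst (add_point a b c u) m) M else 0)"
  by (simp add: mon_subst_add mon_subst_single add_point_eq distrib_left lookup_add mult.commute)

lemma lookup_mon_subst_add_point_self:
  assumes "c \<notin> keys m"
  shows "lookup (mon_subst (add_point a b c u :: nat \<Rightarrow> 'a::comm_ring_1 mpoly) m) m = 1"
  using assms
proof (induction m rule: mon_add_single_induct)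
  case (add m k)
  let ?P = "mon_subst (add_point a b c u) m :: 'a mpoly"
  have 1: "lookup (single (single k 1) 1 * ?P) (m + single k 1) = 1"
    using add lookup_single_mult[of "single k 1" 1 ?P m] by (simp add: keys_add_nat add.commute)
  have 2: "lookup (single (single c 1 + single u k) 1 * ?P) (m + single k 1) = 0"
  proof (rule ccontr)
    assume "\<not> ?thesis"
    then obtain l where "m + single k 1 = single c 1 + single u k + l" by (rule in_keys_single_mult)
    then have "c \<in> keys (m + single k 1)" by (simp add: in_keys_iff lookup_add)
    then show False using add.prems by simp
  qed
  show ?case unfolding lookup_add_point_mult using 1 2 by simp
qed simp

text \<open>Disjointness of q and m leaves a single way to reach this term, namely replacing all of
  q. A shared variable would bring in a binomial coefficient, which may be zero in positive
  characteristic.\<close>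

lemma lookup_mon_subst_add_point_top:
  assumes "c \<notin> keys m" "u \<notin> keys m" "c \<notin> {a..b}" "u \<notin> {a..b}"
    "keys q \<subseteq> {a..b}" "keys q \<inter> keys m = {}"
  shows "lookup (mon_subst (add_point a b c u :: nat \<Rightarrow> 'a::comm_ring_1 mpoly) (m + q))
     (m + single c (mdeg q) + single u (mweight q)) = 1"
  using assms(5,6)
proof (induction q rule: mon_add_single_induct)
  case zero
  then show ?case using assms by (simp add: lookup_mon_subst_add_point_self)
next
  case (add q k)
  let ?P = "mon_subst (add_point a b c u) (m + q) :: 'a mpoly"
  let ?B = "m + single c (mdeg q) + single u (mweight q)"
  let ?M = "m + single c (mdeg (q + single k 1)) + single u (mweight (q + single k 1))"
  have k: "a \<le> k" "k \<le> b" "k \<notin> keys m" using add.prems by (auto simp: keys_add_nat)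
  have IH: "lookup ?P ?B = 1" using add by (auto simp: keys_add_nat)
  have M: "?M = (single c 1 + single u k) + ?B"
    by (rule poly_mapping_eqI) (simp add: lookup_add lookup_single when_def mdeg_add mweight_add)
  have 1: "lookup (single (single k 1) 1 * ?P) ?M = 0"
  proof (rule ccontr)
    assume "\<not> ?thesis"
    then obtain l where "?M = single k 1 + l" by (rule in_keys_single_mult)
    then have "k \<in> keys ?M" by (simp add: in_keys_iff lookup_add)
    then show False using k assms by (auto simp: keys_add_nat split: if_splits)
  qed
  have 2: "lookup (single (single c 1 + single u k) 1 * ?P) ?M = 1"
    unfolding M lookup_single_mult using IH by simp
  show ?case unfolding add.assoc[symmetric] lookup_add_point_mult using 1 2 k by simp
qed

lemma lookup_poly_subst:
  "lookup (poly_subst s p) M = (\<Sum>m\<in>keys p. lookup p m * lookup (mon_subst s m) M)"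
  by (simp add: poly_subst_def lookup_sum lookup_const_mult)

lemma lookup_poly_subst_kill:
  fixes p :: "'a::comm_ring_1 mpoly"
  assumes "keys M \<inter> {a..b} = {}"
  shows "lookup (poly_subst (\<lambda>k. if a \<le> k \<and> k \<le> b then 0 else var k) p) M = lookup p M"
proof -
  let ?s = "\<lambda>k. if a \<le> k \<and> k \<le> b then 0 else var k :: 'a mpoly"
  have *: "mon_subst ?s m = (if keys m \<inter> {a..b} = {} then single m 1 else 0)" for m
  proof (induction m rule: mon_add_single_induct)
    case (add m k)
    then show ?case
      by (auto simp: mon_subst_add mon_subst_single keys_add_nat mult_single var_def)
  qed simp
  have "lookup (poly_subst ?s p) M = (\<Sum>m\<in>keys p. if m = M then lookup p m else 0)"
    unfolding lookup_poly_subst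
    by (rule sum.cong) (use assms in \<open>auto simp: * lookup_single when_def\<close>)
  then show ?thesis by (simp add: in_keys_iff)
qed

text \<open>Peel off one point: if \<open>q0\<close> collects from \<open>\<mu>\<close> the powers of its least variable \<open>x\<^sub>i\<close> in the
  range and of \<open>x\<^bsub>i+1\<^esub>\<close>, then \<open>q0\<close> is least among the monomials of its degree and weight, so among the terms
  carrying \<open>c^deg(q0) u^weight(q0)\<close> the monomial \<open>\<mu> - q0\<close> leads, with the coefficient of \<open>\<mu>\<close>.
  The factor \<open>\<epsilon>\<close> records the variables of the points already peeled off.\<close>

lemma secant_nonzero_aux:
  fixes p :: "'a::comm_ring_1 mpoly"
  assumes "b < N"
    and "\<And>m k. m \<in> keys p \<Longrightarrow> k \<in> keys m \<Longrightarrow> k < N \<or> N + 2 * r \<le> k"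
    and "keys \<epsilon> \<subseteq> {N + 2 * r..}" and "keys \<mu> \<subseteq> {..<N}"
    and "lookup p (\<mu> + \<epsilon>) \<noteq> 0"
    and "\<And>\<nu>. keys \<nu> \<subseteq> {..<N} \<Longrightarrow> lookup p (\<nu> + \<epsilon>) \<noteq> 0 \<Longrightarrow> \<nu> \<le> \<mu>"
    and "\<not> has_spread (Suc r) (keys \<mu> \<inter> {a..b})"
  shows "secant N a b r p \<noteq> 0"
  using assms(2-)
proof (induction r arbitrary: p \<epsilon> \<mu>)
  case 0
  \<comment> \<open>A single index is a spread tuple of length one, so here the monomial has no
    variable in the range and survives setting these to zero.\<close>
  have "keys \<mu> \<inter> {a..b} = {}"
  proof (rule ccontr)
    assume "keys \<mu> \<inter> {a..b} \<noteq> {}"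
    then obtain k where "k \<in> keys \<mu> \<inter> {a..b}" by blast
    then have "has_spread (Suc 0) (keys \<mu> \<inter> {a..b})"
      by (auto simp: has_spread_def spread_def intro!: exI[of _ "\<lambda>_. k"])
    then show False using 0 by simp
  qed
  then have "keys (\<mu> + \<epsilon>) \<inter> {a..b} = {}" using 0(2) assms(1) by (force simp: keys_add_nat)
  then have "lookup (secant N a b 0 p) (\<mu> + \<epsilon>) = lookup p (\<mu> + \<epsilon>)"
    by (simp add: lookup_poly_subst_kill)
  then show ?case using 0(4) by (metis lookup_zero)
next
  case (Suc r)
  define c where "c = N + 2 * r"
  define u where "u = Suc c"
  let ?s = "add_point a b c u :: nat \<Rightarrow> 'a mpoly"
  obtain i \<alpha> \<beta> \<nu> q0
    where q0: "q0 = single i \<alpha> + single (Suc i) \<beta>" "\<mu> = \<nu> + q0" "keys q0 \<subseteq> {a..b}"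
      "keys q0 \<inter> keys \<nu> = {}" "\<not> has_spread (Suc r) (keys \<nu> \<inter> {a..b})"
    by (rule mon_split_adjacent[OF Suc.prems(6)])
  have least: "q0 \<le> q" if "mdeg q = mdeg q0" "mweight q = mweight q0" for q
    unfolding q0(1) by (rule adjacent_mon_least) (use that in \<open>simp_all add: q0(1) mdeg_add mweight_add\<close>)
  define \<epsilon>' where "\<epsilon>' = \<epsilon> + single c (mdeg q0) + single u (mweight q0)"
  have cu: "c \<notin> keys \<epsilon>" "u \<notin> keys \<epsilon>" "c \<ge> N" "u \<ge> N" "c \<noteq> u"
    using Suc.prems(2) by (auto simp: c_def u_def)
  \<comment> \<open>Since m and \<nu>' are free of c and u, comparing the exponents of c and u gives
    q the degree and weight of \<open>q0\<close>; cancelling both powers leaves m' = \<nu>' +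
    \<epsilon>.\<close>
  have key: "\<exists>q. m = \<nu>' + q + \<epsilon> \<and> \<nu>' + q \<le> \<mu> \<and> q0 \<le> q"
    if m: "m \<in> keys p" and \<nu>': "keys \<nu>' \<subseteq> {..<N}" and in_keys: "\<nu>' + \<epsilon>' \<in> keys (mon_subst ?s m)" for m \<nu>'
  proof -
    from keys_mon_subst_add_point[OF in_keys] obtain m' q where
      q: "m = m' + q" "keys q \<subseteq> {a..b}" "\<nu>' + \<epsilon>' = m' + single c (mdeg q) + single u (mweight q)" by blast
    have "c \<notin> keys m" "u \<notin> keys m"
      using Suc.prems(1)[OF m, of c] Suc.prems(1)[OF m, of u] by (auto simp: c_def u_def)
    then have m': "lookup m' c = 0" "lookup m' u = 0" using q(1) by (auto simp: keys_add_nat in_keys_iff)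
    have \<nu>'_cu: "lookup \<nu>' c = 0" "lookup \<nu>' u = 0"
      using \<nu>' cu by (auto simp: in_keys_iff subset_iff not_less[symmetric])
    have "lookup (\<nu>' + \<epsilon>') c = mdeg q" "lookup (\<nu>' + \<epsilon>') u = mweight q"
      using m' cu unfolding q(3) by (simp_all add: lookup_add lookup_single when_def)
    moreover have "lookup (\<nu>' + \<epsilon>') c = mdeg q0" "lookup (\<nu>' + \<epsilon>') u = mweight q0"
      using \<nu>'_cu cu by (auto simp: lookup_add lookup_single when_def \<epsilon>'_def in_keys_iff)
    ultimately have qq: "mdeg q = mdeg q0" "mweight q = mweight q0" by simp_all
    have "m' + (single c (mdeg q0) + single u (mweight q0)) = \<nu>' + \<epsilon> + (single c (mdeg q0) + single u (mweight q0))"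
      using q(3) unfolding qq \<epsilon>'_def by (simp only: ac_simps)
    then have "m' = \<nu>' + \<epsilon>" by (rule add_right_imp_eq)
    then have meq: "m = \<nu>' + q + \<epsilon>" using q(1) by (simp add: ac_simps)
    have "\<nu>' + q \<le> \<mu>"
    proof (rule Suc.prems(5))
      show "keys (\<nu>' + q) \<subseteq> {..<N}" using \<nu>' q(2) assms(1) by (force simp: keys_add_nat)
      show "lookup p (\<nu>' + q + \<epsilon>) \<noteq> 0" using m meq by (simp add: in_keys_iff)
    qed
    then show ?thesis using meq least[OF qq] by blast
  qed
  have \<nu>N: "keys \<nu> \<subseteq> {..<N}" using Suc.prems(3) by (auto simp: q0(2) keys_add_nat)
  have "secant N a b r (poly_subst ?s p) \<noteq> 0"
  proof (rule Suc.IH[of _ \<epsilon>' \<nu>])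
    fix m k assume m: "m \<in> keys (poly_subst ?s p)" "k \<in> keys m"
    then have "(\<Sum>m'\<in>keys p. lookup p m' * lookup (mon_subst ?s m') m) \<noteq> 0"
      by (simp add: in_keys_iff lookup_poly_subst)
    then obtain m' where m': "m' \<in> keys p" "m \<in> keys (mon_subst ?s m')"
      by (metis (no_types, lifting) in_keys_iff mult_zero_right sum.neutral)
    from keys_mon_subst_add_point[OF m'(2)] obtain m'' q where
      "m' = m'' + q" "m = m'' + single c (mdeg q) + single u (mweight q)" by blast
    then have "k \<in> keys m' \<or> k = c \<or> k = u"
      using m(2) by (auto simp: keys_add_nat split: if_splits)
    then show "k < N \<or> N + 2 * r \<le> k"
      using Suc.prems(1)[OF m'(1), of k] by (auto simp: c_def u_def)
  next
    show "keys \<epsilon>' \<subseteq> {N + 2 * r..}"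
      using Suc.prems(2) by (auto simp: \<epsilon>'_def keys_add_nat c_def u_def split: if_splits)
  next
    show "keys \<nu> \<subseteq> {..<N}" by (rule \<nu>N)
  next
    have "lookup (poly_subst ?s p) (\<nu> + \<epsilon>') = (\<Sum>m\<in>keys p. if m = \<mu> + \<epsilon> then lookup p (\<mu> + \<epsilon>) else 0)"
      unfolding lookup_poly_subst
    proof (rule sum.cong[OF refl])
      fix m assume m: "m \<in> keys p"
      show "lookup p m * lookup (mon_subst ?s m) (\<nu> + \<epsilon>') = (if m = \<mu> + \<epsilon> then lookup p (\<mu> + \<epsilon>) else 0)"
      proof (cases "m = \<mu> + \<epsilon>")
        case True
        have "lookup (mon_subst ?s (\<nu> + \<epsilon> + q0)) (\<nu> + \<epsilon> + single c (mdeg q0) + single u (mweight q0)) = 1"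
        proof (rule lookup_mon_subst_add_point_top)
          show "keys q0 \<inter> keys (\<nu> + \<epsilon>) = {}"
            using q0(3,4) Suc.prems(2) assms(1) by (force simp: keys_add_nat)
        qed (use \<nu>N cu q0(3) assms(1) in \<open>auto simp: keys_add_nat\<close>)
        moreover have "m = \<nu> + \<epsilon> + q0" using True q0(2) by (simp add: ac_simps)
        ultimately show ?thesis using True by (simp add: \<epsilon>'_def ac_simps)
      next
        case False
        have "\<nu> + \<epsilon>' \<notin> keys (mon_subst ?s m)"
        proof
          assume "\<nu> + \<epsilon>' \<in> keys (mon_subst ?s m)"
          \<comment> \<open>From \<nu> + q \<le> \<mu> = \<nu> + q0 and q0 \<le> q follows q = q0,
            so only m = \<mu> + \<epsilon> contributes and nothing can cancel its
            coefficient.\<close>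
          from key[OF m \<nu>N this] obtain q where "m = \<nu> + q + \<epsilon>" "\<nu> + q \<le> \<mu>" "q0 \<le> q" by blast
          then show False using False q0(2) by (simp add: antisym)
        qed
        then show ?thesis using False by (simp add: in_keys_iff)
      qed
    qed
    also have "\<dots> = lookup p (\<mu> + \<epsilon>)" by (simp add: in_keys_iff)
    finally show "lookup (poly_subst ?s p) (\<nu> + \<epsilon>') \<noteq> 0" using Suc.prems(4) by simp
  next
    fix \<nu>' assume \<nu>': "keys \<nu>' \<subseteq> {..<N}" "lookup (poly_subst ?s p) (\<nu>' + \<epsilon>') \<noteq> 0"
    then obtain m where m: "m \<in> keys p" "\<nu>' + \<epsilon>' \<in> keys (mon_subst ?s m)"
      unfolding lookup_poly_subst by (metis (no_types, lifting) in_keys_iff mult_zero_right sum.neutral)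
    from key[OF m(1) \<nu>'(1) m(2)] obtain q where "\<nu>' + q \<le> \<mu>" "q0 \<le> q" by blast
    then have "\<nu>' + q \<le> \<nu> + q" using q0(2) by (metis add_left_mono order_trans)
    then show "\<nu>' \<le> \<nu>" by simp
  next
    show "\<not> has_spread (Suc r) (keys \<nu> \<inter> {a..b})" by (rule q0(5))
  qed
  then show ?case by (simp add: c_def u_def)
qed

section \<open>Leading monomials and ideals of the polynomial ring\<close>

abbreviation lead :: "'a::comm_ring_1 mpoly \<Rightarrow> nat \<Rightarrow>\<^sub>0 nat" where
  "lead p \<equiv> Max (keys p)"

lemma lead_in_keys: "p \<noteq> 0 \<Longrightarrow> lead p \<in> keys p"
  by (rule Max_in) auto

lemma secant_nonzero:
  fixes p :: "'a::comm_ring_1 mpoly"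
  assumes "p \<in> polyring n" "p \<noteq> 0" "b < N" "n < N"
    and "\<not> has_spread (Suc r) (keys (lead p) \<inter> {a..b})"
  shows "secant N a b r p \<noteq> 0"
proof (rule secant_nonzero_aux[where \<epsilon> = 0 and \<mu> = "lead p"])
  have keys_lt: "keys m \<subseteq> {..<N}" if "m \<in> keys p" for m
    using that assms unfolding polyring_def by force
  show "k < N \<or> N + 2 * r \<le> k" if "m \<in> keys p" "k \<in> keys m" for m k
    using keys_lt that by blast
  show "keys (lead p) \<subseteq> {..<N}" using keys_lt lead_in_keys assms(2) by blast
  show "lookup p (lead p + 0) \<noteq> 0" using lead_in_keys assms(2) by (simp add: in_keys_iff)
  show "\<nu> \<le> lead p" if "lookup p (\<nu> + 0) \<noteq> 0" for \<nu>
    using that by (simp add: in_keys_iff)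
qed (use assms in auto)

section \<open>Closure properties of the ring in x_1, ..., x_n and of its ideals\<close>

lemma polyring_add: "p \<in> polyring n \<Longrightarrow> q \<in> polyring n \<Longrightarrow> p + q \<in> polyring n"
  unfolding polyring_def using keys_add[of p q] by blast

lemma polyring_mult:
  assumes "p \<in> polyring n" "q \<in> polyring n"
  shows "p * q \<in> polyring n"
  unfolding polyring_def
proof (intro CollectI ballI)
  fix m assume "m \<in> keys (p * q)"
  then obtain a b where "m = a + b" "a \<in> keys p" "b \<in> keys q" using keys_mult[of p q] by blast
  then show "keys m \<subseteq> {1..n}" using assms by (auto simp: polyring_def keys_add_nat)
qed

lemma polyring_zero: "0 \<in> polyring n"
  by (simp add: polyring_def)

lemma polyring_single: "keys m \<subseteq> {1..n} \<Longrightarrow> single m c \<in> polyring n"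
  by (simp add: polyring_def)

lemma polyring_one: "1 \<in> polyring n"
  using polyring_single[of 0 n 1] by simp

lemma polyring_var: "1 \<le> k \<Longrightarrow> k \<le> n \<Longrightarrow> var k \<in> polyring n"
  by (simp add: polyring_def var_def)

lemma polyring_uminus_one: "- 1 \<in> polyring n"
  using polyring_single[of 0 n "- 1"] by (simp add: single_uminus)

lemma polyring_sum: "(\<And>i. i \<in> A \<Longrightarrow> f i \<in> polyring n) \<Longrightarrow> sum f A \<in> polyring n"
  by (induction A rule: infinite_finite_induct) (auto simp: polyring_zero polyring_add)

lemma polyring_prod: "(\<And>i. i \<in> A \<Longrightarrow> f i \<in> polyring n) \<Longrightarrow> prod f A \<in> polyring n"
  by (induction A rule: infinite_finite_induct) (auto simp: polyring_one polyring_mult)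

lemma is_ideal_subset: "is_ideal S I \<Longrightarrow> p \<in> I \<Longrightarrow> p \<in> S"
  by (auto simp: is_ideal_def)

lemma is_ideal_add: "is_ideal S I \<Longrightarrow> p \<in> I \<Longrightarrow> q \<in> I \<Longrightarrow> p + q \<in> I"
  by (auto simp: is_ideal_def)

lemma is_ideal_mult: "is_ideal S I \<Longrightarrow> p \<in> I \<Longrightarrow> r \<in> S \<Longrightarrow> r * p \<in> I"
  by (auto simp: is_ideal_def)

lemma is_ideal_diff: "is_ideal (polyring n) I \<Longrightarrow> p \<in> I \<Longrightarrow> q \<in> I \<Longrightarrow> p - q \<in> I"
  using is_ideal_add[of "polyring n" I p "- 1 * q"] is_ideal_mult[of "polyring n" I q "- 1"]
    polyring_uminus_one by auto

text \<open>The chain x_1 > x_2 > x_3 > ... never ends, so the variables must be finitely many.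
  Bounding those of the larger monomial suffices, since the deciding index has a positive exponent
  there; lists of n exponents then compare lexicographically.\<close>

lemma wf_lex_monomials: "wf {(m, m' :: nat \<Rightarrow>\<^sub>0 nat). m < m' \<and> keys m' \<subseteq> {1..n}}" (is "wf ?R")
proof -
  let ?f = "\<lambda>m :: nat \<Rightarrow>\<^sub>0 nat. map (lookup m) [1..<Suc n]"
  have "?R \<subseteq> inv_image (lex less_than) ?f"
  proof (rule subrelI)
    fix m m' :: "nat \<Rightarrow>\<^sub>0 nat" assume "(m, m') \<in> ?R"
    then obtain k where k: "lookup m k < lookup m' k" "\<forall>k'<k. lookup m k' = lookup m' k'"
      and m': "keys m' \<subseteq> {1..n}" by (auto simp: mon_less_iff)
    have "k \<in> keys m'" using k(1) by (simp add: in_keys_iff)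
    then have "1 \<le> k" "k \<le> n" using m' by auto
    then have split: "[1..<Suc n] = [1..<k] @ k # [Suc k..<Suc n]"
      using upt_add_eq_append[of 1 k "Suc n - k"] by (simp add: upt_conv_Cons)
    have "(?f m, ?f m') \<in> lex less_than"
      unfolding split lex_conv map_append list.map
      by (rule CollectI, rule case_prodI, intro conjI exI[of _ "map (lookup m) [1..<k]"] exI[of _ "lookup m k"]
            exI[of _ "lookup m' k"] exI[of _ "map (lookup m) [Suc k..<Suc n]"] exI[of _ "map (lookup m') [Suc k..<Suc n]"])
         (use k in auto)
    then show "(m, m') \<in> inv_image (lex less_than) ?f" by simp
  qed
  moreover have "wf (inv_image (lex less_than) ?f)" by (intro wf_inv_image wf_lex wf_less_than)
  ultimately show ?thesis by (rule wf_subset[rotated])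
qed

text \<open>Division with remainder. Subtracting a multiple of g removes the leading term without
  inverting coefficients, and g in Q keeps the remainder in Q, where the induction on leading
  monomials applies again.\<close>

lemma ideal_subset_by_leads:
  fixes Q L :: "'a::comm_ring_1 mpoly set"
  assumes Q: "is_ideal (polyring n) Q" and L: "is_ideal (polyring n) L"
    and leads: "\<And>p. p \<in> Q \<Longrightarrow> p \<noteq> 0 \<Longrightarrow>
      \<exists>g \<delta>. g \<in> Q \<and> g \<in> L \<and> lookup g (lead g) = 1 \<and> lead p = lead g + \<delta>"
  shows "Q \<subseteq> L"
proof
  fix p assume "p \<in> Q"
  moreover have "\<forall>p. p \<in> Q \<longrightarrow> p \<noteq> 0 \<longrightarrow> lead p = \<mu> \<longrightarrow> p \<in> L" for \<mu>
  proof (induction \<mu> rule: wf_induct[OF wf_lex_monomials[of n]])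
    case (1 \<mu>)
    show ?case
    proof (intro allI impI)
      fix p assume p: "p \<in> Q" "p \<noteq> 0" "lead p = \<mu>"
      from leads[OF p(1,2)] obtain g \<delta> where g: "g \<in> Q" "g \<in> L" "lookup g (lead g) = 1" "\<mu> = lead g + \<delta>"
        using p(3) by blast
      have \<mu>: "keys \<mu> \<subseteq> {1..n}"
        using is_ideal_subset[OF Q p(1)] lead_in_keys[OF p(2)] p(3) by (auto simp: polyring_def)
      define h where "h = single \<delta> (lookup p \<mu>) * g"
      have "single \<delta> (lookup p \<mu>) \<in> polyring n"
        using \<mu> g(4) by (intro polyring_single) (auto simp: keys_add_nat)
      then have h: "h \<in> Q" "h \<in> L" unfolding h_def using g Q L by (auto intro: is_ideal_mult)
      have diff: "p - h \<in> Q" using is_ideal_diff Q p(1) h(1) by blast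
      have "p - h \<in> L"
      proof (cases "p - h = 0")
        case True then show ?thesis using L by (simp add: is_ideal_def)
      next
        case False
        have le: "m \<le> \<mu>" if "m \<in> keys (p - h)" for m
        proof -
          have "m \<in> keys p \<or> m \<in> keys h"
            using that by (auto simp: in_keys_iff lookup_minus)
          then show ?thesis
          proof
            assume "m \<in> keys p" then show ?thesis using p(3) by auto
          next
            assume "m \<in> keys h"
            then have "lookup (single \<delta> (lookup p \<mu>) * g) m \<noteq> 0" by (simp add: h_def in_keys_iff)
            then obtain l where l: "m = \<delta> + l" "l \<in> keys g" by (rule in_keys_single_mult)
            then have "\<delta> + l \<le> \<delta> + lead g" by (intro add_left_mono) auto
            then show ?thesis using l g(4) by (simp add: add.commute)
          qed
        qed
        have "lookup h \<mu> = lookup p \<mu>"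
          using lookup_single_mult[of \<delta> "lookup p \<mu>" g "lead g"] g(3,4) by (simp add: h_def add.commute)
        then have "\<mu> \<notin> keys (p - h)" by (simp add: in_keys_iff lookup_minus)
        then have "lead (p - h) < \<mu>" using le lead_in_keys[OF False] by (metis order_le_less)
        then show ?thesis using 1 \<mu> diff False by blast
      qed
      then have "p - h + h \<in> L" using h(2) is_ideal_add[OF L] by blast
      then show "p \<in> L" by simp
    qed
  qed
  ultimately show "p \<in> L" using L by (cases "p = 0") (auto simp: is_ideal_def)
qed

section \<open>Minors of Hankel matrices\<close>

definition hankel_minor :: "nat \<Rightarrow> (nat \<Rightarrow> nat) \<Rightarrow> (nat \<Rightarrow> nat) \<Rightarrow> 'a::comm_ring_1 mpoly" where
  "hankel_minor t r c = det (mat t t (\<lambda>(i, j). var (1 + r i + c j)))"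

definition index_mon :: "nat set \<Rightarrow> (nat \<Rightarrow> nat) \<Rightarrow> nat \<Rightarrow>\<^sub>0 nat" where
  "index_mon A f = (\<Sum>i\<in>A. single (f i) 1)"

lemma prod_var: "(\<Prod>i\<in>A. var (f i)) = single (index_mon A f) 1"
  by (induction A rule: infinite_finite_induct) (auto simp: index_mon_def var_def mult_single)

lemma lookup_index_mon: "lookup (index_mon A f) k = (\<Sum>i\<in>A. if f i = k then 1 else 0)"
  unfolding index_mon_def lookup_sum lookup_single when_def ..

lemma lookup_index_mon_inj:
  assumes "finite A" "inj_on f A"
  shows "lookup (index_mon A f) k = (if k \<in> f ` A then 1 else 0)"
proof (cases "k \<in> f ` A")
  case True
  then obtain i where i: "i \<in> A" "k = f i" by blast
  have "(\<Sum>j\<in>A. if f j = k then 1 else (0::nat)) = (\<Sum>j\<in>A. if j = i then 1 else 0)"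
    using i assms by (intro sum.cong) (auto dest: inj_onD)
  then show ?thesis using True i assms by (simp add: lookup_index_mon)
next
  case False
  then show ?thesis by (auto simp: lookup_index_mon intro!: sum.neutral)
qed

lemma hankel_minor_expand:
  "hankel_minor t r c = (\<Sum>p | p permutes {0..<t}.
     signof p * single (index_mon {0..<t} (\<lambda>i. 1 + r i + c (p i))) (1::'a::comm_ring_1))"
proof -
  have "hankel_minor t r c = (\<Sum>p | p permutes {0..<t}. signof p *
     (\<Prod>i = 0..<t. (mat t t (\<lambda>(i, j). var (1 + r i + c j)) :: 'a mpoly mat) $$ (i, p i)))"
    unfolding hankel_minor_def by (rule det_def') simp
  also have "\<dots> = (\<Sum>p | p permutes {0..<t}. signof p * (\<Prod>i = 0..<t. var (1 + r i + c (p i))))"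
  proof (intro sum.cong refl arg_cong2[of _ _ _ _ "(*)"] prod.cong)
    fix p i assume "p \<in> {p. p permutes {0..<t}}" "i \<in> {0..<t}"
    then have "i < t" "p i < t" using permutes_in_image[of p "{0..<t}" i] by auto
    then show "(mat t t (\<lambda>(i, j). var (1 + r i + c j)) :: 'a mpoly mat) $$ (i, p i) = var (1 + r i + c (p i))"
      by simp
  qed
  finally show ?thesis unfolding prod_var .
qed

text \<open>Let \<open>i0\<close> be the first position moved by p. Before it the two products
  agree; from it on every factor of the permuted product has an index above 1 + r i0 + c i0, while
  the diagonal product has a factor with exactly this index.\<close>

lemma index_mon_permuted_less:
  fixes r c :: "nat \<Rightarrow> nat"
  assumes r: "\<And>i j. i < j \<Longrightarrow> j < t \<Longrightarrow> r i < r j" and c: "\<And>i j. i < j \<Longrightarrow> j < t \<Longrightarrow> c i < c j"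
    and p: "p permutes {0..<t}" "p \<noteq> id"
  shows "index_mon {0..<t} (\<lambda>i. 1 + r i + c (p i)) < index_mon {0..<t} (\<lambda>i. 1 + r i + c i)"
proof -
  define i0 where "i0 = (LEAST i. p i \<noteq> i)"
  have ex: "\<exists>i. p i \<noteq> i" using p(2) by (auto simp: fun_eq_iff)
  have i0: "p i0 \<noteq> i0" using LeastI_ex[OF ex] by (simp add: i0_def)
  have fixed: "p i = i" if "i < i0" for i using not_less_Least[of i "\<lambda>i. p i \<noteq> i"] that by (auto simp: i0_def)
  have i0t: "i0 < t"
  proof (rule ccontr)
    assume "\<not> i0 < t" then show False using i0 permutes_not_in[OF p(1), of i0] by simp
  qed
  have inj: "p i = p j \<Longrightarrow> i = j" for i j using permutes_inj[OF p(1)] by (auto dest: injD)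
  have ge: "i0 \<le> p i" if "i0 \<le> i" for i
  proof (rule ccontr)
    assume "\<not> ?thesis"
    then have "p (p i) = p i" using fixed by simp
    then have "p i = i" using inj by blast
    then show False using that \<open>\<not> i0 \<le> p i\<close> by simp
  qed
  have pt: "p i < t" if "i < t" for i using permutes_in_image[OF p(1), of i] that by simp
  have rle: "r i \<le> r j" if "i \<le> j" "j < t" for i j using r[of i j] that by (cases "i = j") auto
  have cle: "c i \<le> c j" if "i \<le> j" "j < t" for i j using c[of i j] that by (cases "i = j") auto
  let ?K = "1 + r i0 + c i0"
  have gt: "?K < 1 + r i + c (p i)" if "i0 \<le> i" "i < t" for i
  proof (cases "i = i0")
    case True
    then have "i0 < p i" using i0 ge[OF that(1)] by simp
    then show ?thesis using c[of i0 "p i"] pt[OF that(2)] True by simp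
  next
    case False
    then show ?thesis using r[of i0 i] cle[OF ge[OF that(1)] pt[OF that(2)]] that by simp
  qed
  have split: "(\<Sum>i\<in>{0..<t}. f i) = (\<Sum>i\<in>{0..<i0}. f i) + (\<Sum>i\<in>{i0..<t}. f i)" for f :: "nat \<Rightarrow> nat"
    using i0t by (simp add: sum.atLeastLessThan_concat)
  have low: "(\<Sum>i\<in>{0..<i0}. if 1 + r i + c (p i) = k then 1 else 0)
      = (\<Sum>i\<in>{0..<i0}. if 1 + r i + c i = k then 1 else (0::nat))" for k
    by (rule sum.cong) (auto simp: fixed)
  have zero: "(\<Sum>i\<in>{i0..<t}. if 1 + r i + c (p i) = k then 1 else (0::nat)) = 0" if "k \<le> ?K" for k
    using that gt by (intro sum.neutral) fastforce
  have gt': "?K \<le> 1 + r i + c i" if "i0 \<le> i" "i < t" for i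
    using rle[OF that] cle[OF that] by simp
  show ?thesis
    unfolding mon_less_iff
  proof (intro exI[of _ ?K] conjI allI impI)
    have "0 < (\<Sum>i\<in>{i0..<t}. if 1 + r i + c i = ?K then 1 else (0::nat))"
      using i0t by (intro sum_pos2[of _ i0]) auto
    then show "lookup (index_mon {0..<t} (\<lambda>i. 1 + r i + c (p i))) ?K
        < lookup (index_mon {0..<t} (\<lambda>i. 1 + r i + c i)) ?K"
      unfolding lookup_index_mon split low using zero[of ?K] by simp
    fix k assume k: "k < ?K"
    have "(\<Sum>i\<in>{i0..<t}. if 1 + r i + c i = k then 1 else (0::nat)) = 0"
      using k gt' by (intro sum.neutral) fastforce
    then show "lookup (index_mon {0..<t} (\<lambda>i. 1 + r i + c (p i))) k
        = lookup (index_mon {0..<t} (\<lambda>i. 1 + r i + c i)) k"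
      unfolding lookup_index_mon split low using zero[of k] k by simp
  qed
qed

lemma lookup_signof_mult:
  fixes p :: "'a::comm_ring_1 mpoly"
  shows "lookup (signof \<sigma> * p) m = signof \<sigma> * lookup p m"
  by (cases rule: sign_cases[of \<sigma>]) auto

lemma lead_hankel_minor:
  fixes r c :: "nat \<Rightarrow> nat"
  assumes r: "\<And>i j. i < j \<Longrightarrow> j < t \<Longrightarrow> r i < r j" and c: "\<And>i j. i < j \<Longrightarrow> j < t \<Longrightarrow> c i < c j"
  defines "\<gamma> \<equiv> index_mon {0..<t} (\<lambda>i. 1 + r i + c i)"
  shows "lead (hankel_minor t r c :: 'a::comm_ring_1 mpoly) = \<gamma>" (is "lead ?g = _")
    and "lookup (hankel_minor t r c :: 'a mpoly) \<gamma> = 1"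
proof -
  let ?m = "\<lambda>p. index_mon {0..<t} (\<lambda>i. 1 + r i + c (p i))"
  have less: "?m p < \<gamma>" if "p permutes {0..<t}" "p \<noteq> id" for p
    unfolding \<gamma>_def by (rule index_mon_permuted_less) (use r c that in auto)
  have look: "lookup ?g k = (\<Sum>p | p permutes {0..<t}. signof p * (if ?m p = k then 1 else 0))" for k
    by (simp add: hankel_minor_expand lookup_sum lookup_signof_mult lookup_single when_def)
  have "lookup ?g \<gamma> = (\<Sum>p | p permutes {0..<t}. if p = id then 1 else 0)"
    unfolding look
  proof (rule sum.cong[OF refl])
    fix p assume "p \<in> {p. p permutes {0..<t}}"
    then show "signof p * (if ?m p = \<gamma> then 1 else 0) = (if p = id then 1 else (0::'a))"
      using less[of p] by (cases "p = id") (auto simp: \<gamma>_def)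
  qed
  also have "\<dots> = 1" by (simp add: finite_permutations permutes_id)
  finally show one: "lookup ?g \<gamma> = 1" .
  have "k \<le> \<gamma>" if "k \<in> keys ?g" for k
  proof -
    have "(\<Sum>p | p permutes {0..<t}. signof p * (if ?m p = k then 1 else (0::'a))) \<noteq> 0"
      using that unfolding look[symmetric] by (simp add: in_keys_iff)
    then obtain p where p: "p permutes {0..<t}" "?m p = k"
      by (rule sum.not_neutral_contains_not_neutral) (auto split: if_splits)
    show ?thesis
    proof (cases "p = id")
      case True
      then show ?thesis using p(2) by (simp add: \<gamma>_def)
    next
      case False
      then show ?thesis using less[OF p(1)] p(2) by simp
    qed
  qed
  moreover have "\<gamma> \<in> keys ?g" using one by (simp add: in_keys_iff)
  ultimately show "lead ?g = \<gamma>" by (intro Max_eqI) auto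
qed

lemma hankel_minor_in_polyring:
  assumes "\<And>i j. i < t \<Longrightarrow> j < t \<Longrightarrow> 1 + r i + c j \<le> n"
  shows "hankel_minor t r c \<in> polyring n"
proof -
  have sgn: "signof p \<in> polyring n" for p
    by (cases rule: sign_cases[of p]) (auto simp: polyring_one polyring_uminus_one)
  show ?thesis
    unfolding hankel_minor_expand prod_var[symmetric]
  proof (intro polyring_sum polyring_mult sgn polyring_prod polyring_var)
    fix p i assume "p \<in> {p. p permutes {0..<t}}" "i \<in> {0..<t}"
    then have "i < t" "p i < t" using permutes_in_image[of p "{0..<t}" i] by auto
    then show "1 + r i + c (p i) \<le> n" by (rule assms)
  qed simp
qed

section \<open>Vanishing of minors under the substitution\<close>

text \<open>Padding by zeros beyond index q makes both factors square, so multiplicativity of the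
  determinant applies; column q of the first factor is zero.\<close>

lemma det_low_rank:
  fixes \<alpha> \<beta> :: "nat \<Rightarrow> nat \<Rightarrow> 'a::comm_ring_1"
  assumes "q < t"
  shows "det (mat t t (\<lambda>(i, j). \<Sum>s<q. \<alpha> s i * \<beta> s j)) = 0"
proof -
  define A where "A = mat t t (\<lambda>(i, s). if s < q then \<alpha> s i else 0)"
  define B where "B = mat t t (\<lambda>(s, j). if s < q then \<beta> s j else 0)"
  have "mat t t (\<lambda>(i, j). \<Sum>s<q. \<alpha> s i * \<beta> s j) = A * B"
  proof (rule eq_matI)
    fix i j assume "i < dim_row (A * B)" "j < dim_col (A * B)"
    then have ij: "i < t" "j < t" by (auto simp: A_def B_def)
    have "(\<Sum>s<q. \<alpha> s i * \<beta> s j) = (\<Sum>s\<in>{0..<t}. if s < q then \<alpha> s i * \<beta> s j else 0)"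
      using assms by (intro sum.mono_neutral_cong_left) auto
    also have "\<dots> = (A * B) $$ (i, j)"
      using ij by (auto simp: A_def B_def scalar_prod_def intro!: sum.cong)
    finally show "mat t t (\<lambda>(i, j). \<Sum>s<q. \<alpha> s i * \<beta> s j) $$ (i, j) = (A * B) $$ (i, j)"
      using ij by simp
  qed (auto simp: A_def B_def)
  moreover have "det (A * B) = det A * det B"
    by (rule det_mult[of _ t]) (auto simp: A_def B_def)
  moreover have "det A = 0"
  proof -
    have "det A = (\<Sum>p | p permutes {0..<t}. signof p * (\<Prod>j<t. A $$ (p j, j)))"
      by (rule det_col) (simp add: A_def)
    also have "\<dots> = 0"
    proof (rule sum.neutral, rule ballI)
      fix p assume "p \<in> {p. p permutes {0..<t}}"
      then have "p q < t" using permutes_in_image[of p "{0..<t}" q] assms by auto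
      then have "A $$ (p q, q) = 0" using assms by (simp add: A_def)
      then have "(\<Prod>j<t. A $$ (p j, j)) = 0"
        using assms by (intro prod_zero) auto
      then show "signof p * (\<Prod>j<t. A $$ (p j, j)) = 0" by simp
    qed
    finally show ?thesis .
  qed
  ultimately show ?thesis by simp
qed

lemma secant_hankel_minor:
  "secant N a b q (hankel_minor t r c :: 'a::comm_ring_1 mpoly) = det (mat t t (\<lambda>(i, j). secant N a b q (var (1 + r i + c j))))"
proof -
  interpret h: comm_ring_hom "secant N a b q :: 'a mpoly \<Rightarrow> 'a mpoly" by (rule secant_hom)
  show ?thesis unfolding hankel_minor_def h.hom_det[symmetric]
    by (rule arg_cong[of _ _ det], rule eq_matI) auto
qed

text \<open>After the substitution the entry at (i, j) is the sum over s of (c_s u_s^(1 + r i))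
  u_s^(c j), so the matrix is a sum of q < t matrices of rank one.\<close>

lemma secant_hankel_minor_zero:
  assumes "b < N" "q < t" and "\<And>i j. i < t \<Longrightarrow> j < t \<Longrightarrow> 1 + r i + c j \<in> {a..b}"
  shows "secant N a b q (hankel_minor t r c) = (0 :: 'a::comm_ring_1 mpoly)"
proof -
  have "mat t t (\<lambda>(i, j). secant N a b q (var (1 + r i + c j)))
    = (mat t t (\<lambda>(i, j). \<Sum>s<q. (var (N + 2 * s) * var (Suc (N + 2 * s)) ^ (1 + r i)) * var (Suc (N + 2 * s)) ^ c j) :: 'a mpoly mat)"
  proof (rule eq_matI, goal_cases)
    case (1 i j)
    then show ?case using assms(3)[of i j] assms(1)
      by (simp add: secant_var_inside power_add mult.assoc)
  qed auto
  then show ?thesis unfolding secant_hankel_minor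
    by (rule trans[OF arg_cong[of _ _ det] det_low_rank[OF assms(2)]])
qed

text \<open>A single corner entry outside \<open>[a, b]\<close> is a perturbation of rank one.\<close>

lemma secant_hankel_minor_zero_corner:
  assumes "b < N" "Suc q < t" "1 + \<rho> + \<rho> \<notin> {a..b}"
    and "\<And>i j. i < t \<Longrightarrow> j < t \<Longrightarrow> 1 + r i + c j \<in> {a..b} \<or> r i = \<rho> \<and> c j = \<rho>"
  shows "secant N a b q (hankel_minor t r c) = (0 :: 'a::comm_ring_1 mpoly)"
proof -
  let ?S = "\<lambda>k. \<Sum>s<q. var (N + 2 * s) * var (Suc (N + 2 * s)) ^ k :: 'a mpoly"
  \<comment> \<open>The summand s = q is supported on the corner. There it replaces the value
    contributed by the q points by the variable that the substitution fixes.\<close>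
  let ?\<alpha> = "\<lambda>s i. if s < q then var (N + 2 * s) * var (Suc (N + 2 * s)) ^ (1 + r i) else if r i = \<rho> then 1 else 0"
  let ?\<beta> = "\<lambda>s j. if s < q then var (Suc (N + 2 * s)) ^ c j else if c j = \<rho> then var (1 + \<rho> + \<rho>) - ?S (1 + \<rho> + \<rho>) else 0"
  have "mat t t (\<lambda>(i, j). secant N a b q (var (1 + r i + c j)))
    = (mat t t (\<lambda>(i, j). \<Sum>s<Suc q. ?\<alpha> s i * ?\<beta> s j) :: 'a mpoly mat)"
  proof (rule eq_matI, goal_cases)
    case (1 i j)
    then have ij: "i < t" "j < t" by auto
    have sum: "(\<Sum>s<Suc q. ?\<alpha> s i * ?\<beta> s j) = ?S (1 + r i + c j)
       + (if r i = \<rho> \<and> c j = \<rho> then var (1 + \<rho> + \<rho>) - ?S (1 + \<rho> + \<rho>) else 0)"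
      by (simp add: power_add mult_ac)
    show ?case
    proof (cases "r i = \<rho> \<and> c j = \<rho>")
      case True
      then have "secant N a b q (var (1 + r i + c j)) = var (1 + \<rho> + \<rho>)"
        using assms(3) by (auto intro!: secant_var_outside)
      then show ?thesis using True ij sum by (simp del: sum.lessThan_Suc)
    next
      case False
      then have "1 + r i + c j \<in> {a..b}" using assms(4)[OF ij] by blast
      then show ?thesis using ij sum False assms(1) by (auto simp: secant_var_inside simp del: sum.lessThan_Suc)
    qed
  qed auto
  then show ?thesis unfolding secant_hankel_minor
    by (rule trans[OF arg_cong[of _ _ det] det_low_rank[OF assms(2)]])
qed

section \<open>Hankel determinantal ideals\<close>

text \<open>Halving the indices rounded down and up keeps rows and columns strictly increasing and within
  the square matrix, with \<open>x\<^bsub>e j\<^esub>\<close> on the diagonal.\<close>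

definition spread_minor :: "nat \<Rightarrow> (nat \<Rightarrow> nat) \<Rightarrow> 'a::comm_ring_1 mpoly" where
  "spread_minor t e = hankel_minor t (\<lambda>j. (e j - 1) div 2) (\<lambda>j. e j div 2)"

text \<open>This is K(t,a,b): t - 1 points give rank at most t - 1, and numbering the new variables
  from \<open>Suc n\<close> on keeps them apart from x_1, ..., x_n.\<close>

definition rank_ideal :: "nat \<Rightarrow> nat \<Rightarrow> nat \<Rightarrow> nat \<Rightarrow> 'a::comm_ring_1 mpoly set" where
  "rank_ideal n t a b = {p \<in> polyring n. secant (Suc n) a b (t - 1) p = 0}"

lemma spread_halves_less:
  assumes "spread t e" "\<forall>j<t. 1 \<le> e j" "i < j" "j < t"
  shows "(e i - 1) div 2 < (e j - 1) div 2" "e i div 2 < e j div 2"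
proof -
  have "e i + 2 \<le> e j" using assms spread_less by blast
  moreover have "1 \<le> e i" using assms by auto
  ultimately show "(e i - 1) div 2 < (e j - 1) div 2" "e i div 2 < e j div 2" by linarith+
qed

text \<open>Halving is monotone, so the entry at (i, j) has an index between e i and e j; on the
  diagonal the two roundings add up to e i - 1. A spread minor therefore involves no variable
  outside the range of its tuple.\<close>

lemma spread_index_in_range:
  assumes "spread t e" "\<forall>j<t. e j \<in> {a..b}" "1 \<le> a" "i < t" "j < t"
  shows "1 + (e i - 1) div 2 + e j div 2 \<in> {a..b}"
proof -
  have e: "1 \<le> e i" "1 \<le> e j" "a \<le> e i" "a \<le> e j" "e i \<le> b" "e j \<le> b"
    using assms by fastforce+
  consider "i < j" | "i = j" | "j < i" by linarith
  then show ?thesis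
  proof cases
    case 1
    then have "e i + 2 \<le> e j" using assms spread_less by blast
    then have "e i \<le> 1 + (e i - 1) div 2 + e j div 2" "1 + (e i - 1) div 2 + e j div 2 \<le> e j"
      using e by linarith+
    then show ?thesis using e by simp
  next
    case 2
    then have "1 + (e i - 1) div 2 + e j div 2 = e i" using e by presburger
    then show ?thesis using e by simp
  next
    case 3
    then have "e j + 2 \<le> e i" using assms spread_less by blast
    then have "e j \<le> 1 + (e i - 1) div 2 + e j div 2" "1 + (e i - 1) div 2 + e j div 2 \<le> e i"
      using e by linarith+
    then show ?thesis using e by simp
  qed
qed

lemma lead_spread_minor:
  assumes "spread t e" "\<forall>j<t. 1 \<le> e j"
  shows "lead (spread_minor t e :: 'a::comm_ring_1 mpoly) = index_mon {0..<t} e"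
    and "lookup (spread_minor t e :: 'a mpoly) (index_mon {0..<t} e) = 1"
proof -
  have "1 + (e i - 1) div 2 + e i div 2 = e i" if "i < t" for i
    using assms(2)[rule_format, OF that] by presburger
  then have eq: "index_mon {0..<t} (\<lambda>i. 1 + (e i - 1) div 2 + e i div 2) = index_mon {0..<t} e"
    unfolding index_mon_def by (intro sum.cong) auto
  note less = spread_halves_less[OF assms]
  show "lead (spread_minor t e :: 'a mpoly) = index_mon {0..<t} e"
    unfolding spread_minor_def eq[symmetric] by (rule lead_hankel_minor) (use less in auto)
  show "lookup (spread_minor t e :: 'a mpoly) (index_mon {0..<t} e) = 1"
    unfolding spread_minor_def eq[symmetric] by (rule lead_hankel_minor) (use less in auto)
qed

lemma spread_minor_in_polyring:
  assumes "spread t e" "\<forall>j<t. e j \<in> {1..n}"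
  shows "spread_minor t e \<in> polyring n"
  unfolding spread_minor_def
  by (rule hankel_minor_in_polyring) (use spread_index_in_range[OF assms] in auto)

lemma is_ideal_rank_ideal: "is_ideal (polyring n) (rank_ideal n t a b :: 'a::comm_ring_1 mpoly set)"
proof -
  interpret h: comm_ring_hom "secant (Suc n) a b (t - 1) :: 'a mpoly \<Rightarrow> 'a mpoly" by (rule secant_hom)
  show ?thesis
    unfolding is_ideal_def rank_ideal_def
    by (auto simp: polyring_zero polyring_add polyring_mult h.hom_add h.hom_mult simp del: One_nat_def)
qed

lemma rank_ideal_prime:
  fixes p q :: "'a::field mpoly"
  assumes "p * q \<in> rank_ideal n t a b" "p \<in> polyring n" "q \<in> polyring n"
  shows "p \<in> rank_ideal n t a b \<or> q \<in> rank_ideal n t a b"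
proof -
  interpret h: comm_ring_hom "secant (Suc n) a b (t - 1) :: 'a mpoly \<Rightarrow> 'a mpoly" by (rule secant_hom)
  show ?thesis using assms by (auto simp: rank_ideal_def h.hom_mult simp del: One_nat_def)
qed

lemma rank_ideal_has_spread:
  assumes "p \<in> rank_ideal n t a b" "p \<noteq> 0" "1 \<le> t" "b \<le> n"
  shows "has_spread t (keys (lead p) \<inter> {a..b})"
proof (rule ccontr)
  assume "\<not> ?thesis"
  then have "secant (Suc n) a b (t - 1) p \<noteq> 0"
    using assms by (intro secant_nonzero[where n = n]) (auto simp: rank_ideal_def)
  then show False using assms by (simp add: rank_ideal_def)
qed

text \<open>A test by counting: the leading monomial of a nonzero member contains t different
  variables of the range.\<close>

lemma spread_minor_not_in_rank_ideal:
  assumes e: "spread u e" "\<forall>j<u. e j \<in> {1..n}" and "1 \<le> t" "b \<le> n"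
    and card: "card {j \<in> {..<u}. e j \<in> {a..b}} < t"
  shows "(spread_minor u e :: 'a::field mpoly) \<notin> rank_ideal n t a b"
proof
  let ?g = "spread_minor u e :: 'a mpoly"
  assume "?g \<in> rank_ideal n t a b"
  have pos: "\<forall>j<u. 1 \<le> e j" using e by auto
  note lead = lead_spread_minor[OF e(1) pos, where 'a = 'a]
  have "?g \<noteq> 0" using lead(2) by (metis lookup_zero zero_neq_one)
  with \<open>?g \<in> _\<close> have "has_spread t (keys (index_mon {0..<u} e) \<inter> {a..b})"
    using rank_ideal_has_spread[of ?g n t a b] assms lead(1) by simp
  then have "t \<le> card (keys (index_mon {0..<u} e) \<inter> {a..b})" by (rule has_spread_card) simp
  also have "keys (index_mon {0..<u} e) \<inter> {a..b} \<subseteq> e ` {j \<in> {..<u}. e j \<in> {a..b}}"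
    using spread_inj_on[OF e(1)]
    by (auto simp: in_keys_iff lookup_index_mon_inj lessThan_atLeast0 split: if_splits)
  then have "card (keys (index_mon {0..<u} e) \<inter> {a..b}) \<le> card {j \<in> {..<u}. e j \<in> {a..b}}"
    by (rule surj_card_le[rotated]) simp
  finally show False using card by simp
qed

text \<open>The product of the x_(e j) is squarefree, so it divides the leading monomial as soon as
  its variables occur there.\<close>

lemma ideal_subset_by_spread_minors:
  fixes Q L :: "'a::comm_ring_1 mpoly set"
  assumes Q: "is_ideal (polyring n) Q" and L: "is_ideal (polyring n) L"
    and leads: "\<And>p. p \<in> Q \<Longrightarrow> p \<noteq> 0 \<Longrightarrow>
      \<exists>t e. spread t e \<and> (\<forall>j<t. e j \<in> keys (lead p)) \<and> spread_minor t e \<in> Q \<and> spread_minor t e \<in> L"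
  shows "Q \<subseteq> L"
proof (rule ideal_subset_by_leads[OF Q L])
  fix p assume p: "p \<in> Q" "p \<noteq> 0"
  from leads[OF p] obtain t e where e: "spread t e" "\<forall>j<t. e j \<in> keys (lead p)"
    "spread_minor t e \<in> Q" "spread_minor t e \<in> L" by blast
  have "keys (lead p) \<subseteq> {1..n}"
    using is_ideal_subset[OF Q p(1)] lead_in_keys[OF p(2)] by (auto simp: polyring_def)
  then have pos: "\<forall>j<t. 1 \<le> e j" using e(2) by force
  note lead = lead_spread_minor[OF e(1) pos, where 'a = 'a]
  have "lead p = index_mon {0..<t} e + (lead p - index_mon {0..<t} e)"
  proof (rule poly_mapping_eqI)
    fix k
    have "lookup (index_mon {0..<t} e) k \<le> lookup (lead p) k"
      using spread_inj_on[OF e(1)] e(2)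
      by (auto simp: lookup_index_mon_inj lessThan_atLeast0 in_keys_iff Suc_le_eq)
    then show "lookup (lead p) k = lookup (index_mon {0..<t} e + (lead p - index_mon {0..<t} e)) k"
      by (simp add: lookup_add lookup_minus)
  qed
  then show "\<exists>g \<delta>. g \<in> Q \<and> g \<in> L \<and> lookup g (lead g) = 1 \<and> lead p = lead g + \<delta>"
    using e(3,4) lead by metis
qed

lemma spread_minor_in_rank_ideal:
  assumes "spread u e" "\<forall>j<u. e j \<in> {a..b}" "1 \<le> a" "b \<le> n" "a' \<le> a" "b \<le> b'" "b' \<le> n" "1 \<le> t" "t \<le> u"
  shows "spread_minor u e \<in> rank_ideal n t a' b'"
proof -
  have "secant (Suc n) a' b' (t - 1) (spread_minor u e) = 0"
    unfolding spread_minor_def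
  proof (rule secant_hankel_minor_zero)
    fix i j assume "i < u" "j < u"
    then have "1 + (e i - 1) div 2 + e j div 2 \<in> {a..b}"
      using spread_index_in_range assms(1-3) by blast
    then show "1 + (e i - 1) div 2 + e j div 2 \<in> {a'..b'}" using assms by auto
  qed (use assms in auto)
  moreover have "spread_minor u e \<in> polyring n"
    by (rule spread_minor_in_polyring) (use assms in force)+
  ultimately show ?thesis by (simp add: rank_ideal_def)
qed

text \<open>The points miss x_1, which can occur only in the corner (0, 0); the extra rank that this
  costs is the reason for the strict t < u.\<close>

lemma spread_minor_in_rank_ideal_low:
  assumes "spread u e" "\<forall>j<u. e j \<in> {1..b}" "b \<le> n" "1 \<le> t" "t < u"
  shows "spread_minor u e \<in> rank_ideal n t 2 b"
proof -
  have "secant (Suc n) 2 b (t - 1) (spread_minor u e) = 0"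
    unfolding spread_minor_def
  proof (rule secant_hankel_minor_zero_corner[where \<rho> = 0])
    fix i j assume "i < u" "j < u"
    then have "1 + (e i - 1) div 2 + e j div 2 \<in> {1..b}"
      using spread_index_in_range assms(1,2) by blast
    then show "1 + (e i - 1) div 2 + e j div 2 \<in> {2..b} \<or> (e i - 1) div 2 = 0 \<and> e j div 2 = 0"
      by (auto simp: Suc_le_eq)
  qed (use assms in auto)
  moreover have "spread_minor u e \<in> polyring n"
    by (rule spread_minor_in_polyring) (use assms in force)+
  ultimately show ?thesis by (simp add: rank_ideal_def)
qed

text \<open>For n = 2\<rho> + 1 the halved indices are at most \<rho>, so x_n can stand only at
  (\<rho>, \<rho>); this is the corner that the points miss.\<close>

lemma spread_minor_in_rank_ideal_high:
  assumes "spread u e" "\<forall>j<u. e j \<in> {a..n}" "1 \<le> a" "odd n" "1 \<le> t" "t < u"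
  shows "spread_minor u e \<in> rank_ideal n t a (n - 1)"
proof -
  have "secant (Suc n) a (n - 1) (t - 1) (spread_minor u e) = 0"
    unfolding spread_minor_def
  proof (rule secant_hankel_minor_zero_corner[where \<rho> = "n div 2"])
    fix i j assume ij: "i < u" "j < u"
    then have range: "1 + (e i - 1) div 2 + e j div 2 \<in> {a..n}"
      using spread_index_in_range assms(1-3) by blast
    have "e i \<le> n" "e j \<le> n" using assms(2) ij by auto
    then have "(e i - 1) div 2 \<le> n div 2" "e j div 2 \<le> n div 2" by linarith+
    moreover have "n = 1 + n div 2 + n div 2" using assms(4) by presburger
    ultimately show "1 + (e i - 1) div 2 + e j div 2 \<in> {a..n - 1}
        \<or> (e i - 1) div 2 = n div 2 \<and> e j div 2 = n div 2"
      using range unfolding atLeastAtMost_iff by linarith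
  next
    have "n = 1 + n div 2 + n div 2" using assms(4) by presburger
    then show "1 + n div 2 + n div 2 \<notin> {a..n - 1}" by auto
  qed (use assms in auto)
  moreover have "spread_minor u e \<in> polyring n"
    by (rule spread_minor_in_polyring) (use assms in force)+
  ultimately show ?thesis by (simp add: rank_ideal_def)
qed

text \<open>So the spread minors on the range generate the ideal, and inclusions of such an ideal in
  another one are checked on them.\<close>

lemma rank_ideal_subset:
  assumes L: "is_ideal (polyring n) L" and "1 \<le> a" "b \<le> n" "1 \<le> t"
    and minors: "\<And>e. spread t e \<Longrightarrow> \<forall>j<t. e j \<in> {a..b} \<Longrightarrow> spread_minor t e \<in> L"
  shows "rank_ideal n t a b \<subseteq> L"
proof (rule ideal_subset_by_spread_minors[OF is_ideal_rank_ideal L])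
  fix p :: "'a mpoly" assume "p \<in> rank_ideal n t a b" "p \<noteq> 0"
  then obtain e where e: "spread t e" "\<forall>j<t. e j \<in> keys (lead p) \<inter> {a..b}"
    using rank_ideal_has_spread assms unfolding has_spread_def by blast
  then have "spread_minor t e \<in> rank_ideal n t a b"
    using assms by (intro spread_minor_in_rank_ideal[of _ _ a b]) auto
  then show "\<exists>t' e. spread t' e \<and> (\<forall>j<t'. e j \<in> keys (lead p)) \<and>
      spread_minor t' e \<in> rank_ideal n t a b \<and> spread_minor t' e \<in> L"
    using e minors by (intro exI[of _ t] exI[of _ e]) auto
qed

section \<open>Splicing spread tuples\<close>

lemma spread_splice:
  assumes "spread s e" "spread t f" "k < s" "k < t" "e k + 2 \<le> f (Suc k)"
  shows "spread t (\<lambda>j. if j \<le> k then e j else f j)"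
  unfolding spread_def
proof (intro allI impI)
  fix j assume j: "Suc j < t"
  consider "Suc j \<le> k" | "j = k" | "k < j" by linarith
  then show "(if j \<le> k then e j else f j) + 2 \<le> (if Suc j \<le> k then e (Suc j) else f (Suc j))"
    using assms j by cases (auto simp: spread_def)
qed

text \<open>Position k is served by both tuples, e k being followed by f k, which is where the extra
  entry comes from.\<close>

lemma spread_splice_shift:
  assumes "spread s e" "spread t f" "k < s" "k < t" "e k + 2 \<le> f k"
  shows "spread (Suc t) (\<lambda>j. if j \<le> k then e j else f (j - 1))"
  unfolding spread_def
proof (intro allI impI)
  fix j assume j: "Suc j < Suc t"
  consider "Suc j \<le> k" | "j = k" | "k < j" by linarith
  then show "(if j \<le> k then e j else f (j - 1)) + 2 \<le> (if Suc j \<le> k then e (Suc j) else f (Suc j - 1))"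
  proof cases
    case 3
    then have "f (j - 1) + 2 \<le> f (Suc (j - 1))" using assms(2)[unfolded spread_def, rule_format, of "j - 1"] j by simp
    then show ?thesis using 3 by simp
  qed (use assms j in \<open>auto simp: spread_def\<close>)
qed

text \<open>If the conclusion fails, e must start at 1 and f must end at n, as either would
  otherwise fit into {2..n - 1}, and neither tuple can be left for the other. They then interlace so
  tightly that e is 1, 3, 5, ... and n = 2t.\<close>

lemma has_spread_splice_odd:
  assumes "odd n" "1 \<le> t" "has_spread t (K \<inter> {1..n - 1})" "has_spread t (K \<inter> {2..n})"
  shows "has_spread (Suc t) (K \<inter> {1..n}) \<or> has_spread t (K \<inter> {2..n - 1})"
proof (rule ccontr)
  assume no: "\<not> ?thesis"
  from assms obtain e f where e: "spread t e" "\<forall>j<t. e j \<in> K \<inter> {1..n - 1}"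
    and f: "spread t f" "\<forall>j<t. f j \<in> K \<inter> {2..n}" unfolding has_spread_def by blast
  have e_ge: "e 0 + 2 * j \<le> e j" if "j < t" for j using spread_gap[OF e(1), of 0 j] that by simp
  have f_le: "f j + 2 * (t - 1 - j) \<le> f (t - 1)" if "j < t" for j
    using spread_gap[OF f(1), of j "t - 1 - j"] that assms(2) by simp
  have e0: "e 0 = 1"
  proof (rule ccontr)
    assume "e 0 \<noteq> 1"
    then have le: "2 \<le> e 0" using e(2)[rule_format, of 0] assms(2) by auto
    have "e j \<in> K \<inter> {2..n - 1}" if "j < t" for j
      using e(2)[rule_format, OF that] e_ge[of j] that le by auto
    then show False using no e(1) unfolding has_spread_def by blast
  qed
  have fn: "f (t - 1) = n"
  proof (rule ccontr)
    assume "f (t - 1) \<noteq> n"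
    then have le: "f (t - 1) \<le> n - 1" using f(2)[rule_format, of "t - 1"] assms(2) by auto
    have "f j \<in> K \<inter> {2..n - 1}" if "j < t" for j
      using f(2)[rule_format, OF that] f_le[of j] that le by auto
    then show False using no f(1) unfolding has_spread_def by blast
  qed
  \<comment> \<open>A gap of two from e s to f s would allow switching to f with position s used
    twice, giving t + 1 entries.\<close>
  have fe: "f s \<le> e s + 1" if "s < t" for s
  proof (rule ccontr)
    assume "\<not> ?thesis"
    then have "spread (Suc t) (\<lambda>j. if j \<le> s then e j else f (j - 1))"
      using that e f by (intro spread_splice_shift[of t]) auto
    moreover have "(if j \<le> s then e j else f (j - 1)) \<in> K \<inter> {1..n}" if "j < Suc t" for j
    proof (cases "j \<le> s")
      case True then show ?thesis using e(2)[rule_format, of j] \<open>s < t\<close> by auto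
    next
      case False
      then have "f (j - 1) \<in> K \<inter> {2..n}" using f(2) that by auto
      then show ?thesis using False by auto
    qed
    ultimately show False using no unfolding has_spread_def by blast
  qed
  \<comment> \<open>Switching from f to e would avoid both ends: f reaches n only at its last
    position, which is dropped, and e has 1 only at its first.\<close>
  have ef: "e (Suc s) \<le> f s + 1" if "Suc s < t" for s
  proof (rule ccontr)
    assume "\<not> ?thesis"
    then have "spread t (\<lambda>j. if j \<le> s then f j else e j)"
      using that e f by (intro spread_splice[of t]) auto
    moreover have "(if j \<le> s then f j else e j) \<in> K \<inter> {2..n - 1}" if "j < t" for j
    proof (cases "j \<le> s")
      case True
      then have "f j + 2 * 1 \<le> f j + 2 * (t - 1 - j)" using \<open>Suc s < t\<close> by (intro add_left_mono mult_le_mono) auto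
      then have "f j + 2 \<le> n" using f_le[OF that] fn by simp
      then show ?thesis using True f(2) that by auto
    next
      case False
      then have "2 \<le> e j" using e_ge[OF that] e0 by (cases j) auto
      then show ?thesis using False e(2) that by auto
    qed
    ultimately show False using no unfolding has_spread_def by blast
  qed
  \<comment> \<open>The two bounds alternate: e (s + 1) \<le> f s + 1 \<le> e s + 2.\<close>
  have "e s \<le> 1 + 2 * s" if "s < t" for s
    using that
  proof (induction s)
    case (Suc s)
    then show ?case using ef[of s] fe[of s] by simp
  qed (simp add: e0)
  then have "e (t - 1) \<le> 1 + 2 * (t - 1)" using assms(2) by simp
  then have "n \<le> 2 * t" using fe[of "t - 1"] fn assms(2) by simp
  moreover have "e (t - 1) \<le> n - 1" "1 + 2 * (t - 1) \<le> e (t - 1)"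
    using e(2) e_ge[of "t - 1"] e0 assms(2) by auto
  ultimately have "n = 2 * t" using assms(1,2) by (cases n) auto
  then show False using assms(1) by simp
qed

text \<open>The same interlacing with e longer by one, so that now e itself runs from 1 to n.
  Passing from e to f at the same position gains an entry and avoids n; passing from f to e avoids
  1. If neither is possible, e t \<le> 1 + 2t, against e t = n.\<close>

lemma has_spread_splice:
  assumes "Suc (2 * t) < n" "1 \<le> t" "has_spread (Suc t) (K \<inter> {1..n})" "has_spread t (K \<inter> {2..n - 1})"
  shows "has_spread (Suc t) (K \<inter> {1..n - 1}) \<or> has_spread (Suc t) (K \<inter> {2..n})"
proof (rule ccontr)
  assume no: "\<not> ?thesis"
  from assms obtain e f where e: "spread (Suc t) e" "\<forall>j<Suc t. e j \<in> K \<inter> {1..n}"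
    and f: "spread t f" "\<forall>j<t. f j \<in> K \<inter> {2..n - 1}" unfolding has_spread_def by blast
  have e_ge: "e 0 + 2 * j \<le> e j" if "j \<le> t" for j using spread_gap[OF e(1), of 0 j] that by simp
  have e_le: "e j + 2 * (t - j) \<le> e t" if "j \<le> t" for j
    using spread_gap[OF e(1), of j "t - j"] that by simp
  have e0: "e 0 = 1"
  proof (rule ccontr)
    assume "e 0 \<noteq> 1"
    then have le: "2 \<le> e 0" using e(2)[rule_format, of 0] by auto
    have "e j \<in> K \<inter> {2..n}" if "j < Suc t" for j
      using e(2)[rule_format, OF that] e_ge[of j] that le by auto
    then show False using no e(1) unfolding has_spread_def by blast
  qed
  have en: "e t = n"
  proof (rule ccontr)
    assume "e t \<noteq> n"
    then have le: "e t \<le> n - 1" using e(2)[rule_format, of t] by auto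
    have "e j \<in> K \<inter> {1..n - 1}" if "j < Suc t" for j
      using e(2)[rule_format, OF that] e_le[of j] that le by auto
    then show False using no e(1) unfolding has_spread_def by blast
  qed
  have fe: "f s \<le> e s + 1" if "s < t" for s
  proof (rule ccontr)
    assume "\<not> ?thesis"
    then have "spread (Suc t) (\<lambda>j. if j \<le> s then e j else f (j - 1))"
      using that e f by (intro spread_splice_shift[of "Suc t"]) auto
    moreover have "(if j \<le> s then e j else f (j - 1)) \<in> K \<inter> {1..n - 1}" if "j < Suc t" for j
    proof (cases "j \<le> s")
      case True
      then have "e j + 2 * 1 \<le> e j + 2 * (t - j)" using \<open>s < t\<close> by (intro add_left_mono mult_le_mono) auto
      then have "e j + 2 \<le> n" using e_le[of j] that en by simp
      then show ?thesis using True e(2) that by auto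
    next
      case False
      then have "f (j - 1) \<in> K \<inter> {2..n - 1}" using f(2) that by auto
      then show ?thesis using False by auto
    qed
    ultimately show False using no unfolding has_spread_def by blast
  qed
  have ef: "e (Suc s) \<le> f s + 1" if "s < t" for s
  proof (rule ccontr)
    assume "\<not> ?thesis"
    then have "spread (Suc t) (\<lambda>j. if j \<le> s then f j else e j)"
      using that e f by (intro spread_splice[of t]) auto
    moreover have "(if j \<le> s then f j else e j) \<in> K \<inter> {2..n}" if "j < Suc t" for j
    proof (cases "j \<le> s")
      case True
      then have "f j \<in> K \<inter> {2..n - 1}" using f(2) \<open>s < t\<close> by auto
      then show ?thesis using True by auto
    next
      case False
      then have "2 \<le> e j" using e_ge[of j] that e0 by (cases j) auto
      then show ?thesis using False e(2) that by auto
    qed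
    ultimately show False using no unfolding has_spread_def by blast
  qed
  have "e s \<le> 1 + 2 * s" if "s \<le> t" for s
    using that
  proof (induction s)
    case (Suc s)
    then show ?case using ef[of s] fe[of s] by simp
  qed (simp add: e0)
  then show False using en assms(1) by force
qed

section \<open>Sums and colons of Hankel determinantal ideals\<close>

lemma is_ideal_sum:
  assumes "is_ideal S I" "is_ideal S J" "\<And>p q. p \<in> S \<Longrightarrow> q \<in> S \<Longrightarrow> p + q \<in> S"
  shows "is_ideal S (ideal_sum I J)"
  unfolding is_ideal_def
proof (intro conjI ballI)
  have "I \<subseteq> S" "J \<subseteq> S" using assms by (auto simp: is_ideal_def)
  then show "ideal_sum I J \<subseteq> S" using assms(3) by (auto simp: ideal_sum_def)
  have "0 \<in> I" "0 \<in> J" using assms by (auto simp: is_ideal_def)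
  then have "0 + 0 \<in> ideal_sum I J" unfolding ideal_sum_def by blast
  then show "0 \<in> ideal_sum I J" by simp
next
  fix p q assume "p \<in> ideal_sum I J" "q \<in> ideal_sum I J"
  then obtain a b c d where "p = a + b" "q = c + d" "a \<in> I" "c \<in> I" "b \<in> J" "d \<in> J"
    unfolding ideal_sum_def by blast
  then have "p + q = (a + c) + (b + d)" "a + c \<in> I" "b + d \<in> J"
    using assms by (auto simp: is_ideal_def algebra_simps)
  then show "p + q \<in> ideal_sum I J" unfolding ideal_sum_def by blast
next
  fix p r assume "p \<in> ideal_sum I J" "r \<in> S"
  then obtain a b where "p = a + b" "a \<in> I" "b \<in> J" unfolding ideal_sum_def by blast
  then have "r * p = r * a + r * b" "r * a \<in> I" "r * b \<in> J"
    using assms \<open>r \<in> S\<close> by (auto simp: is_ideal_def algebra_simps)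
  then show "r * p \<in> ideal_sum I J" unfolding ideal_sum_def by blast
qed

lemma ideal_sum_upper:
  assumes "is_ideal S I" "is_ideal S J"
  shows "I \<subseteq> ideal_sum I J" "J \<subseteq> ideal_sum I J"
proof -
  have z: "0 \<in> I" "0 \<in> J" using assms by (auto simp: is_ideal_def)
  show "I \<subseteq> ideal_sum I J"
  proof
    fix p assume "p \<in> I"
    moreover have "p = p + 0" by simp
    ultimately show "p \<in> ideal_sum I J" using z unfolding ideal_sum_def by blast
  qed
  show "J \<subseteq> ideal_sum I J"
  proof
    fix p assume "p \<in> J"
    moreover have "p = 0 + p" by simp
    ultimately show "p \<in> ideal_sum I J" using z unfolding ideal_sum_def by blast
  qed
qed

lemma ideal_sum_least:
  assumes "is_ideal S P" "I \<subseteq> P" "J \<subseteq> P"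
  shows "ideal_sum I J \<subseteq> P"
  using assms unfolding ideal_sum_def is_ideal_def by blast

lemma is_ideal_Int: "is_ideal S I \<Longrightarrow> is_ideal S J \<Longrightarrow> is_ideal S (I \<inter> J)"
  unfolding is_ideal_def by blast

text \<open>Some b in J lies outside P, and p * b in P then gives p in P.\<close>

lemma ideal_colon_Int_prime:
  assumes P: "is_ideal S P" and J: "is_ideal S J"
    and prime: "\<And>p q. p * q \<in> P \<Longrightarrow> p \<in> S \<Longrightarrow> q \<in> S \<Longrightarrow> p \<in> P \<or> q \<in> P"
    and not_sub: "\<not> J \<subseteq> P"
  shows "ideal_colon S (P \<inter> J) J = P"
proof
  show "ideal_colon S (P \<inter> J) J \<subseteq> P"
    using J prime not_sub unfolding ideal_colon_def is_ideal_def by blast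
  show "P \<subseteq> ideal_colon S (P \<inter> J) J"
  proof
    fix p assume p: "p \<in> P"
    then have "p * b \<in> P \<inter> J" if "b \<in> J" for b
      using that P J unfolding is_ideal_def by (metis IntI mult.commute subsetD)
    then show "p \<in> ideal_colon S (P \<inter> J) J"
      using p P by (auto simp: ideal_colon_def is_ideal_def)
  qed
qed

lemma is_ideal_rank_ideal_sum:
  "is_ideal (polyring n) (ideal_sum (rank_ideal n t a b) (rank_ideal n t' a' b'))"
  by (intro is_ideal_sum is_ideal_rank_ideal polyring_add)

text \<open>Minors of size t + 1 can afford one exempt corner, x_n in \<open>sub1\<close> and x_1 in
  \<open>sub2\<close>, while \<open>sub3\<close> and \<open>sub4\<close> only enlarge the range. The
  reverse inclusion is the splicing of tuples.\<close>

lemma rank_ideal_Int_eq_sum_odd: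
  assumes "odd n" "1 \<le> t"
  shows "rank_ideal n t 1 (n - 1) \<inter> rank_ideal n t 2 n
       = ideal_sum (rank_ideal n (Suc t) 1 n) (rank_ideal n t 2 (n - 1) :: 'a::comm_ring_1 mpoly set)"
    (is "?P1 \<inter> ?P2 = ideal_sum ?I1 ?I2")
proof
  have sub1: "?I1 \<subseteq> ?P1"
    by (rule rank_ideal_subset[OF is_ideal_rank_ideal])
       (use assms in \<open>auto intro!: spread_minor_in_rank_ideal_high simp del: One_nat_def\<close>)
  have sub2: "?I1 \<subseteq> ?P2"
    by (rule rank_ideal_subset[OF is_ideal_rank_ideal])
       (use assms in \<open>auto intro!: spread_minor_in_rank_ideal_low\<close>)
  have sub3: "?I2 \<subseteq> ?P1"
    by (rule rank_ideal_subset[OF is_ideal_rank_ideal])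
       (use assms in \<open>auto intro!: spread_minor_in_rank_ideal[where a = 2 and b = "n - 1"]\<close>)
  have sub4: "?I2 \<subseteq> ?P2"
    by (rule rank_ideal_subset[OF is_ideal_rank_ideal])
       (use assms in \<open>auto intro!: spread_minor_in_rank_ideal[where a = 2 and b = "n - 1"]\<close>)
  show "ideal_sum ?I1 ?I2 \<subseteq> ?P1 \<inter> ?P2"
    by (rule ideal_sum_least[OF is_ideal_Int[OF is_ideal_rank_ideal is_ideal_rank_ideal]])
       (use sub1 sub2 sub3 sub4 in auto)
  have upper: "?I1 \<subseteq> ideal_sum ?I1 ?I2" "?I2 \<subseteq> ideal_sum ?I1 ?I2"
    by (rule ideal_sum_upper[OF is_ideal_rank_ideal is_ideal_rank_ideal])+
  show "?P1 \<inter> ?P2 \<subseteq> ideal_sum ?I1 ?I2"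
  proof (rule ideal_subset_by_spread_minors[OF is_ideal_Int[OF is_ideal_rank_ideal is_ideal_rank_ideal] is_ideal_rank_ideal_sum])
    fix p :: "'a mpoly" assume p: "p \<in> ?P1 \<inter> ?P2" "p \<noteq> 0"
    then have "has_spread t (keys (lead p) \<inter> {1..n - 1})" "has_spread t (keys (lead p) \<inter> {2..n})"
      using assms by (auto intro!: rank_ideal_has_spread)
    from has_spread_splice_odd[OF assms this]
    show "\<exists>t e. spread t e \<and> (\<forall>j<t. e j \<in> keys (lead p)) \<and> spread_minor t e \<in> ?P1 \<inter> ?P2
        \<and> spread_minor t e \<in> ideal_sum ?I1 ?I2"
    proof
      assume "has_spread (Suc t) (keys (lead p) \<inter> {1..n})"
      then obtain e where e: "spread (Suc t) e" "\<forall>j<Suc t. e j \<in> keys (lead p) \<inter> {1..n}"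
        by (auto simp: has_spread_def)
      then have "spread_minor (Suc t) e \<in> ?I1"
        by (intro spread_minor_in_rank_ideal[of _ _ 1 n]) auto
      then show ?thesis using e sub1 sub2 upper by (intro exI[of _ "Suc t"] exI[of _ e]) auto
    next
      assume "has_spread t (keys (lead p) \<inter> {2..n - 1})"
      then obtain e where e: "spread t e" "\<forall>j<t. e j \<in> keys (lead p) \<inter> {2..n - 1}"
        by (auto simp: has_spread_def)
      then have "spread_minor t e \<in> ?I2"
        using assms by (intro spread_minor_in_rank_ideal[of _ _ 2 "n - 1"]) auto
      then show ?thesis using e sub3 sub4 upper by (intro exI[of _ t] exI[of _ e]) auto
    qed
  qed
qed

text \<open>The second formula of the overview with t + 1 for t, so that both ranks are positive.
  Here \<open>sub2\<close> exempts x_1 and \<open>sub4\<close> exempts x_n.\<close>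

lemma rank_ideal_Int_eq_sum:
  assumes "odd n" "1 \<le> t" "Suc (2 * t) < n"
  shows "rank_ideal n (Suc t) 1 n \<inter> rank_ideal n t 2 (n - 1)
       = ideal_sum (rank_ideal n (Suc t) 1 (n - 1)) (rank_ideal n (Suc t) 2 n :: 'a::comm_ring_1 mpoly set)"
    (is "?P1 \<inter> ?P2 = ideal_sum ?I1 ?I2")
proof
  have sub1: "?I1 \<subseteq> ?P1"
    by (rule rank_ideal_subset[OF is_ideal_rank_ideal])
       (use assms in \<open>auto intro!: spread_minor_in_rank_ideal[where a = 1 and b = "n - 1"]\<close>)
  have sub2: "?I1 \<subseteq> ?P2"
    by (rule rank_ideal_subset[OF is_ideal_rank_ideal])
       (use assms in \<open>auto intro!: spread_minor_in_rank_ideal_low\<close>)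
  have sub3: "?I2 \<subseteq> ?P1"
    by (rule rank_ideal_subset[OF is_ideal_rank_ideal])
       (use assms in \<open>auto intro!: spread_minor_in_rank_ideal[where a = 2 and b = n]\<close>)
  have sub4: "?I2 \<subseteq> ?P2"
    by (rule rank_ideal_subset[OF is_ideal_rank_ideal])
       (use assms in \<open>auto intro!: spread_minor_in_rank_ideal_high simp del: One_nat_def\<close>)
  show "ideal_sum ?I1 ?I2 \<subseteq> ?P1 \<inter> ?P2"
    by (rule ideal_sum_least[OF is_ideal_Int[OF is_ideal_rank_ideal is_ideal_rank_ideal]])
       (use sub1 sub2 sub3 sub4 in auto)
  have upper: "?I1 \<subseteq> ideal_sum ?I1 ?I2" "?I2 \<subseteq> ideal_sum ?I1 ?I2"
    by (rule ideal_sum_upper[OF is_ideal_rank_ideal is_ideal_rank_ideal])+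
  show "?P1 \<inter> ?P2 \<subseteq> ideal_sum ?I1 ?I2"
  proof (rule ideal_subset_by_spread_minors[OF is_ideal_Int[OF is_ideal_rank_ideal is_ideal_rank_ideal] is_ideal_rank_ideal_sum])
    fix p :: "'a mpoly" assume p: "p \<in> ?P1 \<inter> ?P2" "p \<noteq> 0"
    then have "has_spread (Suc t) (keys (lead p) \<inter> {1..n})" "has_spread t (keys (lead p) \<inter> {2..n - 1})"
      using assms by (auto intro!: rank_ideal_has_spread)
    from has_spread_splice[OF assms(3,2) this]
    show "\<exists>t e. spread t e \<and> (\<forall>j<t. e j \<in> keys (lead p)) \<and> spread_minor t e \<in> ?P1 \<inter> ?P2
        \<and> spread_minor t e \<in> ideal_sum ?I1 ?I2"
    proof
      assume "has_spread (Suc t) (keys (lead p) \<inter> {1..n - 1})"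
      then obtain e where e: "spread (Suc t) e" "\<forall>j<Suc t. e j \<in> keys (lead p) \<inter> {1..n - 1}"
        by (auto simp: has_spread_def)
      then have "spread_minor (Suc t) e \<in> ?I1"
        by (intro spread_minor_in_rank_ideal[of _ _ 1 "n - 1"]) auto
      then show ?thesis using e sub1 sub2 upper by (intro exI[of _ "Suc t"] exI[of _ e]) auto
    next
      assume "has_spread (Suc t) (keys (lead p) \<inter> {2..n})"
      then obtain e where e: "spread (Suc t) e" "\<forall>j<Suc t. e j \<in> keys (lead p) \<inter> {2..n}"
        by (auto simp: has_spread_def)
      then have "spread_minor (Suc t) e \<in> ?I2"
        using assms by (intro spread_minor_in_rank_ideal[of _ _ 2 n]) auto
      then show ?thesis using e sub3 sub4 upper by (intro exI[of _ "Suc t"] exI[of _ e]) auto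
    qed
  qed
qed

text \<open>Without points the substitution just kills the range, so both sides are generated by
  x_1, ..., x_n. This is the second formula at t = 1, where K(0,2,n-1) is the unit ideal: the sum is
  already the prime wanted, and no colon is taken.\<close>

lemma rank_ideal_one_eq_sum:
  assumes "2 \<le> n"
  shows "rank_ideal n 1 1 n
       = ideal_sum (rank_ideal n 1 1 (n - 1)) (rank_ideal n 1 2 n :: 'a::comm_ring_1 mpoly set)"
    (is "?P = ideal_sum ?I1 ?I2")
proof
  have "?I1 \<subseteq> ?P"
    by (rule rank_ideal_subset[OF is_ideal_rank_ideal])
       (use assms in \<open>auto intro!: spread_minor_in_rank_ideal[where a = 1 and b = "n - 1"]\<close>)
  moreover have "?I2 \<subseteq> ?P"
    by (rule rank_ideal_subset[OF is_ideal_rank_ideal])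
       (use assms in \<open>auto intro!: spread_minor_in_rank_ideal[where a = 2 and b = n]\<close>)
  ultimately show "ideal_sum ?I1 ?I2 \<subseteq> ?P" by (rule ideal_sum_least[OF is_ideal_rank_ideal])
  have upper: "?I1 \<subseteq> ideal_sum ?I1 ?I2" "?I2 \<subseteq> ideal_sum ?I1 ?I2"
    by (rule ideal_sum_upper[OF is_ideal_rank_ideal is_ideal_rank_ideal])+
  show "?P \<subseteq> ideal_sum ?I1 ?I2"
  proof (rule rank_ideal_subset[OF is_ideal_rank_ideal_sum])
    fix e assume e: "spread 1 e" "\<forall>j<1. e j \<in> {1..n}"
    show "spread_minor 1 e \<in> ideal_sum ?I1 ?I2"
    proof (cases "e 0 = 1")
      case True
      then have "spread_minor 1 e \<in> ?I1"
        using e assms by (intro spread_minor_in_rank_ideal[of _ _ 1 "n - 1"]) auto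
      then show ?thesis using upper by blast
    next
      case False
      then have "spread_minor 1 e \<in> ?I2"
        using e assms by (intro spread_minor_in_rank_ideal[of _ _ 2 n]) (auto simp: Suc_le_eq)
      then show ?thesis using upper by blast
    qed
  qed (use assms in auto)
qed

section \<open>Non-containments that make the colons work\<close>

text \<open>The set A bounds the positions at which e falls into [a', b']; with fewer than t of
  them, the spread minor of e separates the two ideals.\<close>

lemma rank_ideal_not_subset:
  assumes "spread u e" "\<forall>j<u. e j \<in> {a..b}" "1 \<le> u" "1 \<le> a" "b \<le> n" "1 \<le> t" "b' \<le> n"
    and "{j \<in> {..<u}. e j \<in> {a'..b'}} \<subseteq> A" "finite A" "card A < t"
  shows "\<not> (rank_ideal n u a b :: 'a::field mpoly set) \<subseteq> rank_ideal n t a' b'"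
proof
  assume sub: "(rank_ideal n u a b :: 'a mpoly set) \<subseteq> rank_ideal n t a' b'"
  have "card {j \<in> {..<u}. e j \<in> {a'..b'}} < t"
    using card_mono[OF assms(9,8)] assms(10) by linarith
  then have "(spread_minor u e :: 'a mpoly) \<notin> rank_ideal n t a' b'"
    using assms by (intro spread_minor_not_in_rank_ideal) auto
  moreover have "(spread_minor u e :: 'a mpoly) \<in> rank_ideal n u a b"
    using assms by (intro spread_minor_in_rank_ideal[of _ _ a b]) auto
  ultimately show False using sub by blast
qed

lemma rank_ideal_not_subset_high_low:
  assumes "1 \<le> t" "2 * t < n"
  shows "\<not> (rank_ideal n t 2 n :: 'a::field mpoly set) \<subseteq> rank_ideal n t 1 (n - 1)"
  \<comment> \<open>The tightest tuple ending at n: only its last entry leaves {1..n - 1}.\<close>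
  by (rule rank_ideal_not_subset[where e = "\<lambda>j. n + 2 * j - 2 * (t - 1)" and A = "{..<t - 1}"])
     (use assms in \<open>auto simp: spread_def\<close>)

lemma rank_ideal_not_subset_low_high:
  assumes "1 \<le> t" "2 * t < n"
  shows "\<not> (rank_ideal n t 1 (n - 1) :: 'a::field mpoly set) \<subseteq> rank_ideal n t 2 n"
  \<comment> \<open>The tuple 1, 3, 5, ...: only its first entry leaves {2..n}.\<close>
  by (rule rank_ideal_not_subset[where e = "\<lambda>j. 1 + 2 * j" and A = "{1..<t}"])
     (use assms in \<open>auto simp: spread_def\<close>)

lemma rank_ideal_not_subset_Suc:
  assumes "1 \<le> t" "2 * t < n"
  shows "\<not> (rank_ideal n t 2 (n - 1) :: 'a::field mpoly set) \<subseteq> rank_ideal n (Suc t) 1 n"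
  \<comment> \<open>A minor of size t has too few diagonal entries for rank index t + 1, whichever
    tuple is taken; 2, 4, ..., 2t fits.\<close>
  by (rule rank_ideal_not_subset[where e = "\<lambda>j. 2 + 2 * j" and A = "{..<t}"])
     (use assms in \<open>auto simp: spread_def\<close>)

lemma rank_ideal_Suc_not_subset:
  assumes "1 \<le> t" "2 * t < n"
  shows "\<not> (rank_ideal n (Suc t) 1 n :: 'a::field mpoly set) \<subseteq> rank_ideal n t 2 (n - 1)"
  \<comment> \<open>The tuple 1, 3, ..., 2t - 1, n: both ends leave {2..n - 1}, and t - 1 entries
    remain.\<close>
  by (rule rank_ideal_not_subset[where e = "\<lambda>j. if j = t then n else 1 + 2 * j" and A = "{1..<t}"])
     (use assms in \<open>auto simp: spread_def\<close>)

section \<open>Descent inside the class\<close>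

lemma classC_rank_ideal_colon:
  fixes f :: "'a::field mpoly"
  assumes "rank_ideal n t a b \<inter> J \<in> classC (polyring n) f" "is_ideal (polyring n) J"
    "\<not> J \<subseteq> rank_ideal n t a b"
  shows "rank_ideal n t a b \<in> classC (polyring n) f"
proof -
  have "ideal_colon (polyring n) (rank_ideal n t a b \<inter> J) J = rank_ideal n t a b"
    using assms by (intro ideal_colon_Int_prime is_ideal_rank_ideal rank_ideal_prime) auto
  then show ?thesis using classC.colon[OF assms(1,2)] by simp
qed

lemma classC_rank_ideal_step_odd:
  fixes f :: "'a::field mpoly"
  assumes "odd n" "1 \<le> t" "2 * t < n"
    and "rank_ideal n (Suc t) 1 n \<in> classC (polyring n) f" "rank_ideal n t 2 (n - 1) \<in> classC (polyring n) f"
  shows "rank_ideal n t 1 (n - 1) \<in> classC (polyring n) f" "rank_ideal n t 2 n \<in> classC (polyring n) f"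
proof -
  have *: "rank_ideal n t 1 (n - 1) \<inter> rank_ideal n t 2 n \<in> classC (polyring n) f"
    unfolding rank_ideal_Int_eq_sum_odd[OF assms(1,2)] by (rule classC.sum) fact+
  show "rank_ideal n t 1 (n - 1) \<in> classC (polyring n) f"
    by (rule classC_rank_ideal_colon[OF * is_ideal_rank_ideal rank_ideal_not_subset_high_low[OF assms(2,3)]])
  show "rank_ideal n t 2 n \<in> classC (polyring n) f"
    by (rule classC_rank_ideal_colon[OF *[unfolded Int_commute[of "rank_ideal n t 1 (n - 1)"]]
          is_ideal_rank_ideal rank_ideal_not_subset_low_high[OF assms(2,3)]])
qed

lemma classC_rank_ideal_step:
  fixes f :: "'a::field mpoly"
  assumes "odd n" "1 \<le> t" "Suc (2 * t) < n"
    and "rank_ideal n (Suc t) 1 (n - 1) \<in> classC (polyring n) f" "rank_ideal n (Suc t) 2 n \<in> classC (polyring n) f"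
  shows "rank_ideal n (Suc t) 1 n \<in> classC (polyring n) f" "rank_ideal n t 2 (n - 1) \<in> classC (polyring n) f"
proof -
  have t: "2 * t < n" using assms(3) by simp
  have *: "rank_ideal n (Suc t) 1 n \<inter> rank_ideal n t 2 (n - 1) \<in> classC (polyring n) f"
    unfolding rank_ideal_Int_eq_sum[OF assms(1-3)] by (rule classC.sum) fact+
  show "rank_ideal n (Suc t) 1 n \<in> classC (polyring n) f"
    by (rule classC_rank_ideal_colon[OF * is_ideal_rank_ideal rank_ideal_not_subset_Suc[OF assms(2) t]])
  show "rank_ideal n t 2 (n - 1) \<in> classC (polyring n) f"
    by (rule classC_rank_ideal_colon[OF *[unfolded Int_commute[of "rank_ideal n (Suc t) 1 n"]]
          is_ideal_rank_ideal rank_ideal_Suc_not_subset[OF assms(2) t]])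
qed

text \<open>The induction carries a pair, because each step starts from the sum K(k+1,1,n) +
  K(k,2,n-1). One step uses both formulas in turn, passing through the pair K(k,1,n-1), K(k,2,n). At
  t = 1 the second member would be the unit ideal and is dropped.\<close>

lemma classC_rank_ideal_descend:
  fixes f :: "'a::field mpoly"
  assumes n: "n = 2 * m - 1" and t: "1 \<le> t" "t \<le> m"
    and top: "rank_ideal n m 1 n \<in> classC (polyring n) f"
    and top': "2 \<le> m \<Longrightarrow> rank_ideal n (m - 1) 2 (n - 1) \<in> classC (polyring n) f"
  shows "rank_ideal n t 1 n \<in> classC (polyring n) f
     \<and> (2 \<le> t \<longrightarrow> rank_ideal n (t - 1) 2 (n - 1) \<in> classC (polyring n) f)"
  using t(2)
proof (induction rule: inc_induct)
  case base
  then show ?case using top top' by blast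
next
  case (step k)
  have k: "1 \<le> k" "k < m" using step.hyps t by auto
  then have odd: "odd n" "2 * k < n" using n by auto
  note CD = classC_rank_ideal_step_odd[OF odd(1) k(1) odd(2), of f]
  have IH: "rank_ideal n (Suc k) 1 n \<in> classC (polyring n) f" "rank_ideal n k 2 (n - 1) \<in> classC (polyring n) f"
    using step.IH k by auto
  show ?case
  proof (cases "k = 1")
    case True
    have "ideal_sum (rank_ideal n 1 1 (n - 1)) (rank_ideal n 1 2 n) \<in> classC (polyring n) f"
      using CD[OF IH] True by (intro classC.sum) auto
    then show ?thesis using True rank_ideal_one_eq_sum[of n, where 'a = 'a] odd by simp
  next
    case False
    then obtain l where l: "k = Suc l" "1 \<le> l" using k(1) by (cases k) auto
    have "Suc (2 * l) < n" using odd(2) l by simp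
    from classC_rank_ideal_step[OF odd(1) l(2) this, of f] show ?thesis
      using CD[OF IH] l by simp
  qed
qed

section \<open>Principal ideals and ideals of minors\<close>

lemma ideal_gen_least: "is_ideal S I \<Longrightarrow> A \<subseteq> I \<Longrightarrow> ideal_gen S A \<subseteq> I"
  unfolding ideal_gen_def by blast

lemma ideal_gen_upper: "A \<subseteq> ideal_gen S A"
  unfolding ideal_gen_def by blast

lemma is_ideal_polyring: "is_ideal (polyring n) (polyring n)"
  by (auto simp: is_ideal_def polyring_zero polyring_add polyring_mult)

lemma is_ideal_ideal_gen:
  assumes "A \<subseteq> polyring n"
  shows "is_ideal (polyring n) (ideal_gen (polyring n) A)"
proof -
  have "ideal_gen (polyring n) A \<subseteq> polyring n"
    by (rule ideal_gen_least[OF is_ideal_polyring assms])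
  then show ?thesis unfolding is_ideal_def[of _ "ideal_gen (polyring n) A"]
    by (auto simp: ideal_gen_def is_ideal_def)
qed

lemma ideal_gen_principal:
  fixes g :: "'a::comm_ring_1 mpoly"
  assumes "g \<in> polyring n"
  shows "ideal_gen (polyring n) {g} = (\<lambda>r. r * g) ` polyring n"
proof
  have "is_ideal (polyring n) ((\<lambda>r. r * g) ` polyring n)"
    unfolding is_ideal_def
  proof (intro conjI ballI)
    show "0 \<in> (\<lambda>r. r * g) ` polyring n" by (rule image_eqI[of _ _ 0]) (auto simp: polyring_zero)
  next
    fix p q assume "p \<in> (\<lambda>r. r * g) ` polyring n" "q \<in> (\<lambda>r. r * g) ` polyring n"
    then show "p + q \<in> (\<lambda>r. r * g) ` polyring n"
      by (auto simp: distrib_right[symmetric] polyring_add)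
  next
    fix p r :: "'a mpoly" assume "p \<in> (\<lambda>r. r * g) ` polyring n" "r \<in> polyring n"
    then show "r * p \<in> (\<lambda>r. r * g) ` polyring n"
      by (auto simp: mult.assoc[symmetric] polyring_mult)
  qed (auto simp: assms polyring_mult)
  moreover have "g \<in> (\<lambda>r. r * g) ` polyring n" by (rule image_eqI[of _ _ 1]) (auto simp: polyring_one)
  ultimately show "ideal_gen (polyring n) {g} \<subseteq> (\<lambda>r. r * g) ` polyring n"
    by (intro ideal_gen_least) auto
  show "(\<lambda>r. r * g) ` polyring n \<subseteq> ideal_gen (polyring n) {g}"
    unfolding ideal_gen_def by (auto simp: is_ideal_def)
qed

text \<open>The colon of (g h) by (h) is (g), by cancelling h in a domain.\<close>

lemma classC_principal_factor:
  fixes g h :: "'a::field mpoly"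
  assumes g: "g \<in> polyring n" and h: "h \<in> polyring n" and "h \<noteq> 0"
  shows "ideal_gen (polyring n) {g} \<in> classC (polyring n) (g * h)"
proof -
  have gh: "g * h \<in> polyring n" using g h by (rule polyring_mult)
  have "ideal_colon (polyring n) (ideal_gen (polyring n) {g * h}) (ideal_gen (polyring n) {h})
      = ideal_gen (polyring n) {g}"
    unfolding ideal_gen_principal[OF g] ideal_gen_principal[OF h] ideal_gen_principal[OF gh]
  proof (intro equalityI subsetI)
    fix p assume "p \<in> ideal_colon (polyring n) ((\<lambda>r. r * (g * h)) ` polyring n) ((\<lambda>r. r * h) ` polyring n)"
    then have "p * (1 * h) \<in> (\<lambda>r. r * (g * h)) ` polyring n"
      using polyring_one unfolding ideal_colon_def by blast
    then obtain r where r: "r \<in> polyring n" "p * h = (r * g) * h" by (auto simp: mult.assoc)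
    then have "p = r * g" using assms(3) mult_right_cancel by blast
    then show "p \<in> (\<lambda>r. r * g) ` polyring n" using r by blast
  next
    fix p assume "p \<in> (\<lambda>r. r * g) ` polyring n"
    then obtain r where r: "r \<in> polyring n" "p = r * g" by blast
    have "p * (s * h) \<in> (\<lambda>r. r * (g * h)) ` polyring n" if "s \<in> polyring n" for s
      by (rule image_eqI[of _ _ "r * s"]) (use r that in \<open>auto simp: mult_ac polyring_mult\<close>)
    then show "p \<in> ideal_colon (polyring n) ((\<lambda>r. r * (g * h)) ` polyring n) ((\<lambda>r. r * h) ` polyring n)"
      using r g by (auto simp: ideal_colon_def polyring_mult)
  qed
  then show ?thesis
    using classC.colon[OF classC.base is_ideal_ideal_gen, of "{h}" n "g * h"] h by simp
qed

lemma hankel_minor_cong: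
  assumes "\<And>i. i < t \<Longrightarrow> r i = r' i" "\<And>i. i < t \<Longrightarrow> c i = c' i"
  shows "hankel_minor t r c = hankel_minor t r' c'"
  unfolding hankel_minor_def by (rule arg_cong[of _ _ det], rule eq_matI) (use assms in auto)

text \<open>Meant for ranges so short that only one spread tuple fits, where a single minor
  generates the ideal.\<close>

lemma rank_ideal_principal:
  fixes g :: "'a::comm_ring_1 mpoly"
  assumes "g \<in> rank_ideal n t a b" "1 \<le> a" "b \<le> n" "1 \<le> t"
    and "\<And>e. spread t e \<Longrightarrow> \<forall>j<t. e j \<in> {a..b} \<Longrightarrow> spread_minor t e = g"
  shows "rank_ideal n t a b = ideal_gen (polyring n) {g}"
proof
  have g: "g \<in> polyring n" using assms(1) by (simp add: rank_ideal_def)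
  show "rank_ideal n t a b \<subseteq> ideal_gen (polyring n) {g}"
    by (rule rank_ideal_subset[OF is_ideal_ideal_gen])
       (use g assms ideal_gen_upper[of "{g}" "polyring n"] in auto)
  show "ideal_gen (polyring n) {g} \<subseteq> rank_ideal n t a b"
    by (rule ideal_gen_least[OF is_ideal_rank_ideal]) (use assms in auto)
qed

text \<open>The t - 1 gaps of two already use up the whole interval.\<close>

lemma spread_full:
  assumes "spread t e" "\<forall>j<t. e j \<in> {a..a + 2 * (t - 1)}" "j < t"
  shows "e j = a + 2 * j"
proof -
  have "e 0 + 2 * j \<le> e (0 + j)" by (rule spread_gap[OF assms(1)]) (use assms in auto)
  moreover have "e j + 2 * (t - 1 - j) \<le> e (j + (t - 1 - j))"
    by (rule spread_gap[OF assms(1)]) (use assms in auto)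
  moreover have "e 0 \<in> {a..a + 2 * (t - 1)}" "e (t - 1) \<in> {a..a + 2 * (t - 1)}"
    using assms(2,3) by auto
  ultimately show ?thesis using assms(3) by auto
qed

lemma rank_ideal_hankel_det:
  assumes "1 \<le> m"
  shows "rank_ideal (2 * m - 1) m 1 (2 * m - 1) = ideal_gen (polyring (2 * m - 1)) {hankel_minor m (\<lambda>i. i) (\<lambda>j. j)}"
proof (rule rank_ideal_principal)
  show "hankel_minor m (\<lambda>i. i) (\<lambda>j. j) \<in> rank_ideal (2 * m - 1) m 1 (2 * m - 1)"
    unfolding rank_ideal_def using assms
    by (auto intro!: secant_hankel_minor_zero hankel_minor_in_polyring)
next
  fix e assume e: "spread m e" "\<forall>j<m. e j \<in> {1..2 * m - 1}"
  have "2 * m - 1 = 1 + 2 * (m - 1)" using assms by simp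
  then have "e j = 1 + 2 * j" if "j < m" for j using spread_full[of m e 1 j] e that by simp
  then show "spread_minor m e = hankel_minor m (\<lambda>i. i) (\<lambda>j. j)"
    unfolding spread_minor_def by (intro hankel_minor_cong) auto
qed (use assms in auto)

text \<open>The entries x_(2+i+j) of the inner matrix are read as x_(1 + i + (j+1)), that is, with
  columns shifted by one; halving the only tuple 2, 4, ..., 2m - 2 down and up gives just these rows
  and columns.\<close>

lemma rank_ideal_hankel_inner_det:
  assumes "2 \<le> m"
  shows "rank_ideal (2 * m - 1) (m - 1) 2 (2 * m - 1 - 1)
    = ideal_gen (polyring (2 * m - 1)) {hankel_minor (m - 1) (\<lambda>i. i) (\<lambda>j. j + 1)}"
proof (rule rank_ideal_principal)
  show "hankel_minor (m - 1) (\<lambda>i. i) (\<lambda>j. j + 1) \<in> rank_ideal (2 * m - 1) (m - 1) 2 (2 * m - 1 - 1)"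
    unfolding rank_ideal_def using assms
    by (auto intro!: secant_hankel_minor_zero hankel_minor_in_polyring)
next
  fix e assume e: "spread (m - 1) e" "\<forall>j<m - 1. e j \<in> {2..2 * m - 1 - 1}"
  have "2 * m - 1 - 1 = 2 + 2 * (m - 1 - 1)" using assms by simp
  then have "e j = 2 + 2 * j" if "j < m - 1" for j using spread_full[of "m - 1" e 2 j] e that by simp
  then show "spread_minor (m - 1) e = hankel_minor (m - 1) (\<lambda>i. i) (\<lambda>j. j + 1)"
    unfolding spread_minor_def by (intro hankel_minor_cong) auto
qed (use assms in auto)

lemma hankel_minor_nonzero:
  assumes "\<And>i j. i < j \<Longrightarrow> j < t \<Longrightarrow> r i < r j" "\<And>i j. i < j \<Longrightarrow> j < t \<Longrightarrow> c i < c j"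
  shows "hankel_minor t r c \<noteq> (0 :: 'a::field mpoly)"
  using lead_hankel_minor(2)[of t r c, where 'a = 'a] assms by (metis lookup_zero zero_neq_one)

section \<open>From index functions to the submatrices of the statement\<close>

text \<open>\<open>pick\<close> enumerates a set in increasing order, and a strictly increasing r
  already lists its image that way. This links the index sets of \<open>submatrix\<close> with the
  index functions of \<open>hankel_minor\<close>.\<close>

lemma pick_image:
  assumes "\<And>i j. i < j \<Longrightarrow> j < t \<Longrightarrow> r i < r j" "i < t"
  shows "pick (r ` {..<t}) i = r i"
proof -
  have less_iff: "r j < r i \<longleftrightarrow> j < i" if "j < t" for j
    using assms(1)[of i j] assms(1)[of j i] that assms(2) by (cases i j rule: linorder_cases) auto
  have "{x \<in> r ` {..<t}. x < r i} = r ` {..<i}"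
    using less_iff assms(2) by auto
  moreover have "inj_on r {..<t}"
    by (rule linorder_inj_onI) (use assms(1) in force)+
  then have "card (r ` {..<i}) = i"
    using assms(2) by (subst card_image) (auto intro: inj_on_subset)
  ultimately show ?thesis using pick_card_in_set[of "r i" "r ` {..<t}"] assms(2) by simp
qed

lemma hankel_square:
  assumes "1 \<le> m"
  shows "hankel m 1 (2 * m - 1) = mat m m (\<lambda>(i, j). var (1 + i + j))"
  unfolding hankel_def by (rule eq_matI) (use assms in auto)

lemma submatrix_hankel:
  assumes "1 \<le> m" "R \<subseteq> {..<m}" "C \<subseteq> {..<m}" "card R = t" "card C = t"
  shows "det (submatrix (hankel m 1 (2 * m - 1)) R C) = hankel_minor t (pick R) (pick C)"
proof -
  have dims: "dim_row (hankel m 1 (2 * m - 1)) = m" "dim_col (hankel m 1 (2 * m - 1)) = m"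
    using assms by (simp_all add: hankel_square del: One_nat_def)
  have eq: "{i. i < m \<and> i \<in> R} = R" "{i. i < m \<and> i \<in> C} = C" using assms by auto
  have R: "pick R i < m" if "i < t" for i using pick_le[of i m R] that assms eq by simp
  have C: "pick C i < m" if "i < t" for i using pick_le[of i m C] that assms eq by simp
  have "submatrix (hankel m 1 (2 * m - 1)) R C = mat t t (\<lambda>(i, j). var (1 + pick R i + pick C j) :: 'a mpoly)"
    unfolding submatrix_def dims eq assms(4,5)
    by (rule eq_matI) (use R C assms(1) in \<open>auto simp: hankel_square simp del: One_nat_def\<close>)
  then show ?thesis by (simp add: hankel_minor_def)
qed

text \<open>All t-minors vanish on t - 1 points, and the spread minors, which generate the kernel,
  are among them.\<close>

lemma minor_ideal_hankel:
  assumes "1 \<le> t" "t \<le> m"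
  shows "minor_ideal (polyring (2 * m - 1)) t (hankel m 1 (2 * m - 1) :: 'a::comm_ring_1 mpoly mat)
    = rank_ideal (2 * m - 1) t 1 (2 * m - 1)" (is "minor_ideal (polyring ?n) t ?X = ?K")
proof -
  have dims: "dim_row ?X = m" "dim_col ?X = m" using assms by (simp_all add: hankel_square del: One_nat_def)
  have sub: "minors t ?X \<subseteq> ?K"
  proof
    fix g assume "g \<in> minors t ?X"
    then obtain R C where RC: "g = det (submatrix ?X R C)" "R \<subseteq> {..<m}" "C \<subseteq> {..<m}" "card R = t" "card C = t"
      unfolding minors_def dims by blast
    then have g: "g = hankel_minor t (pick R) (pick C)" using submatrix_hankel[of m R C t] assms by simp
    have eq: "{i. i < m \<and> i \<in> R} = R" "{i. i < m \<and> i \<in> C} = C" using RC by auto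
    have pick_lt: "pick R i < m" "pick C i < m" if "i < t" for i
      using pick_le[of i m R] pick_le[of i m C] that RC eq by simp_all
    have "1 + pick R i + pick C j \<in> {1..?n}" if "i < t" "j < t" for i j
      using pick_lt(1)[OF that(1)] pick_lt(2)[OF that(2)] by auto
    then show "g \<in> ?K" unfolding g rank_ideal_def using assms
      by (auto intro!: secant_hankel_minor_zero hankel_minor_in_polyring)
  qed
  have sub_S: "minors t ?X \<subseteq> polyring ?n" using sub by (auto simp: rank_ideal_def)
  show ?thesis unfolding minor_ideal_def
  proof
    show "ideal_gen (polyring ?n) (minors t ?X) \<subseteq> ?K"
      by (rule ideal_gen_least[OF is_ideal_rank_ideal sub])
    show "?K \<subseteq> ideal_gen (polyring ?n) (minors t ?X)"
    proof (rule rank_ideal_subset[OF is_ideal_ideal_gen[OF sub_S]])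
      fix e assume e: "spread t e" "\<forall>j<t. e j \<in> {1..?n}"
      let ?r = "\<lambda>j. (e j - 1) div 2" and ?c = "\<lambda>j. e j div 2"
      have pos: "\<forall>j<t. 1 \<le> e j" using e by auto
      note less = spread_halves_less[OF e(1) pos]
      have inj: "inj_on ?r {..<t}" "inj_on ?c {..<t}"
        by (rule linorder_inj_onI; use less in force)+
      have lt: "?r j < m" "?c j < m" if "j < t" for j
      proof -
        have "e j \<le> ?n" using e(2) that by auto
        then show "?r j < m" "?c j < m" using assms by linarith+
      qed
      have "det (submatrix ?X (?r ` {..<t}) (?c ` {..<t}))
          = hankel_minor t (pick (?r ` {..<t})) (pick (?c ` {..<t}))"
        by (rule submatrix_hankel) (use assms lt inj in \<open>auto simp: card_image\<close>)
      also have "\<dots> = spread_minor t e"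
        unfolding spread_minor_def by (intro hankel_minor_cong pick_image less)
      finally have "spread_minor t e = det (submatrix ?X (?r ` {..<t}) (?c ` {..<t}))" ..
      moreover have "?r ` {..<t} \<subseteq> {..<m}" "?c ` {..<t} \<subseteq> {..<m}"
        "card (?r ` {..<t}) = t" "card (?c ` {..<t}) = t"
        using lt inj by (auto simp: card_image)
      ultimately have "spread_minor t e \<in> minors t ?X"
        unfolding minors_def dims by blast
      then show "spread_minor t e \<in> ideal_gen (polyring ?n) (minors t ?X)"
        using ideal_gen_upper by blast
    qed (use assms in auto)
  qed
qed

theorem theorem3p2:
  fixes m n t :: nat
  assumes "m \<ge> 1" and "n = 2 * m - 1" and "1 \<le> t" and "t \<le> m"
  shows "minor_ideal (polyring n) t (hankel m 1 n :: 'a::field mpoly mat)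
           \<in> classC (polyring n)
               (det (hankel m 1 n :: 'a mpoly mat) * det (hankel (m - 1) 2 (n - 1)))"
proof -
  define g where "g = (hankel_minor m (\<lambda>i. i) (\<lambda>j. j) :: 'a mpoly)"
  define h where "h = (hankel_minor (m - 1) (\<lambda>i. i) (\<lambda>j. j + 1) :: 'a mpoly)"
  have det_g: "det (hankel m 1 n) = g"
    unfolding g_def hankel_minor_def hankel_def
    by (rule arg_cong[of _ _ det], rule eq_matI) (use assms in auto)
  have det_h: "det (hankel (m - 1) 2 (n - 1)) = h"
    unfolding h_def hankel_minor_def hankel_def
    by (rule arg_cong[of _ _ det], rule eq_matI) (use assms in auto)
  have S: "g \<in> polyring n" "h \<in> polyring n"
    unfolding g_def h_def using assms by (auto intro!: hankel_minor_in_polyring)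
  have nz: "g \<noteq> 0" "h \<noteq> 0"
    unfolding g_def h_def by (rule hankel_minor_nonzero; simp)+
  have "rank_ideal n t 1 n \<in> classC (polyring n) (g * h)"
  proof (rule conjunct1[OF classC_rank_ideal_descend[OF assms(2-4)]])
    show "rank_ideal n m 1 n \<in> classC (polyring n) (g * h)"
      using classC_principal_factor[OF S nz(2)] rank_ideal_hankel_det[OF assms(1), where 'a = 'a] assms(2)
      by (simp add: g_def)
    \<comment> \<open>For m = 1 the inner matrix is empty and h = 1, so the descent asks for no
      inner ideal.\<close>
    assume "2 \<le> m"
    from rank_ideal_hankel_inner_det[OF this, where 'a = 'a]
    show "rank_ideal n (m - 1) 2 (n - 1) \<in> classC (polyring n) (g * h)"
      using classC_principal_factor[OF S(2,1) nz(1)] assms(2)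
      by (simp add: h_def mult.commute)
  qed
  then show ?thesis
    unfolding det_g det_h using minor_ideal_hankel[OF assms(3,4), where 'a = 'a] assms(2) by simp
qed

end
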